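(* Let $q\in\{0,1\}$, and assume $\gamma(\theta)=\gamma(\pi+\theta)$ for all $\theta$ if $q=0$, and $3\gamma(\theta)>\gamma(\pi+\theta)$ for all $\theta$ if $q=1$. Let $(\vec X^m,\mu^m,\kappa^m)\in\mathbb X^h\times\mathbb K^h\times\mathbb K_0^h$, $m=0,\dots,M$, be a solution of the following scheme (AC-PFEM): for each $0\le m\le M-1$, $$\left(\frac{\vec X^{m+1}-\vec X^m}{\Delta t}\cdot\vec n^{m+\frac12},\phi^h\right)_{\Gamma^m}^h+\left(\partial_s\mu^{m+1},\partial_s\phi^h\right)_{\Gamma^m}^h=0,\quad\forall\phi^h\in\mathbb K^h,$$ $$\left(\mu^{m+1},\vec n^{m+\frac12}\cdot\vec\omega^h\right)_{\Gamma^m}^h-\left(\boldsymbol B_q(\theta^m)\partial_s\vec X^{m+1},\partial_s\vec\omega^h\right)_{\Gamma^m}^h-\varepsilon^2\left(\partial_s\kappa^{m+1}\vec n^m-\tfrac12(\kappa^{m+1})^2\partial_s\vec X^{m+1},\partial_s\vec\omega^h\right)_{\Gamma^m}^h$$ $$-\frac1\eta\left(\frac{x_l^{m+1}-x_l^m}{\Delta t}\omega_1^h(0)+\frac{x_r^{m+1}-x_r^m}{\Delta t}\omega_1^h(1)\right)+\sigma\left(\omega_1^h(1)-\omega_1^h(0)\right)=0,\quad\forall\vec\omega^h=(\omega_1^h,\omega_2^h)^T\in\mathbb X^h,$$ $$\left(\frac{\kappa^{m+1}-\kappa^m}{\Delta t},\varphi^h\right)_{\Gamma^m}^h-\left(\vec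 n^m\cdot\partial_s\left(\frac{\vec X^{m+1}-\vec X^m}{\Delta t}\right),\partial_s\varphi^h\right)_{\Gamma^m}^h+\left(\partial_s\vec X^{m+1}\cdot\partial_s\left(\frac{\vec X^{m+1}-\vec X^m}{\Delta t}\right)\kappa^{m+1},\varphi^h\right)_{\Gamma^m}^h=0,\quad\forall\varphi^h\in\mathbb K_0^h,$$ where $\vec n^{m+\frac12}=-\frac12\left(\partial_s\vec X^m+\partial_s\vec X^{m+1}\right)^\perp=-\frac12|\partial_\rho\vec X^m|^{-1}\left(\partial_\rho\vec X^m+\partial_\rho\vec X^{m+1}\right)^\perp$. Define, for $m=0,\dots,M$, with $(x_j^m,y_j^m)^T=\vec X^m(\rho_j)$, $$A^m=\frac12\sum_{j=1}^J(x_j^m-x_{j-1}^m)(y_j^m+y_{j-1}^m),$$ $$W_c^m=\sum_{j=1}^J|\vec h_j^m|\gamma(\theta_j^m)+\frac{\varepsilon^2}{4}\sum_{j=1}^J|\vec h_j^m|\left((\kappa^m)^2(\rho_{j-1})+(\kappa^m)^2(\rho_j)\right)-\sigma\left(x_r^m-x_l^m\right).$$ Then the area is conserved: $A^m=A^0$ for all $m=0,\dots,M$. Moreover, there exists a minimal stabilizing function $\mathscr S_0(\theta)$ (i.e. the function $\mathscr S_0:[-\pi,\pi]\to\mathbb R$ defined in the context for the given $q$ is well defined and finite) such that, whenever $\mathscr S(\theta)\ge\mathscr S_0(\theta)$ for all $\theta\in[-\pi,\pi]$, the discrete energy is dissipative: $$W_c^{m+1}\le W_c^m\le\dots\le W_c^0,\qquad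 0\le m\le M-1.$$
   Context: **Data.** $\gamma(\theta)$ is a positive $C^2$ function on $[-\pi,\pi]$, extended $2\pi$-periodically as a $C^2$ function. Constants: $0<\varepsilon\le1$, $\eta\in(0,\infty)$, $\sigma\in\mathbb R$, time step $\Delta t>0$. For $q=0,1$, $$\boldsymbol B_q(\theta)=\begin{pmatrix}\gamma(\theta)&-\gamma'(\theta)\\\gamma'(\theta)&\gamma(\theta)\end{pmatrix}\begin{pmatrix}\cos2\theta&\sin2\theta\\\sin2\theta&-\cos2\theta\end{pmatrix}^{1-q}+\mathscr S(\theta)\left[\frac12\boldsymbol I-\frac12\begin{pmatrix}\cos2\theta&\sin2\theta\\\sin2\theta&-\cos2\theta\end{pmatrix}\right],$$ where $\boldsymbol I$ is the $2\times2$ identity matrix and $\mathscr S:[-\pi,\pi]\to\mathbb R$ is a stability function. **Minimal stabilizing function.** For $q=0$, $\mathscr S_0(\theta)$ is the infimum of the values $\mathscr S(\theta)\in\mathbb R$ for which $$\left[\gamma(\theta)\boldsymbol B_0(\theta)(\cos\hat\theta,\sin\hat\theta)^T\right]\cdot(\cos\hat\theta,\sin\hat\theta)^T\ge\gamma(\hat\theta)^2\quad\forall\hat\theta\in[-\pi,\pi].$$ For $q=1$, $\mathscr S_0(\theta)=\inf\{\alpha\ge0:\ P_\alpha(\theta,\hat\theta)-Q(\theta,\hat\theta)\ge0\ \ \forall\hat\theta\in[-\pi,\pi]\}$, where $$P_\alpha(\theta,\hat\theta)=2\sqrt{\left(\gamma(\theta)+\alpha(-\sin\hat\theta\cos\theta+\cos\hat\theta\sin\theta)^2\right)\gamma(\theta)},$$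 $$Q(\theta,\hat\theta)=\gamma(\hat\theta)+\gamma(\theta)(\sin\theta\sin\hat\theta+\cos\theta\cos\hat\theta)+\gamma'(\theta)(-\sin\hat\theta\cos\theta+\cos\hat\theta\sin\theta).$$ **Discretization.** $\mathbb I=[0,1]$ is divided into $\mathbb I_j=[\rho_{j-1},\rho_j]$, $\rho_j=jh$, $h=1/J$, $j=1,\dots,J$. $\mathbb K^h$ is the space of continuous functions on $\mathbb I$ that are affine on each $\mathbb I_j$; $\mathbb K_0^h=\{u\in\mathbb K^h:u(0)=u(1)=0\}$; $\mathbb X^h=\mathbb K^h\times\mathbb K_0^h$. The polygonal curve $\Gamma^m$ is given by $\vec X^m=(x^m,y^m)^T\in\mathbb X^h$, with contact points $x_l^m=x^m(0)$, $x_r^m=x^m(1)$, and edges $\vec h_j^m=\vec X^m(\rho_j)-\vec X^m(\rho_{j-1})$, all assumed nonzero. On $\mathbb I_j$ the unit tangent is $\vec h_j^m/|\vec h_j^m|=(\cos\theta_j^m,\sin\theta_j^m)^T$, which defines $\theta^m|_{\mathbb I_j}=\theta_j^m\in[-\pi,\pi]$, and the unit normal is $\vec n^m|_{\mathbb I_j}=-(\vec h_j^m)^\perp/|\vec h_j^m|=(-\sin\theta_j^m,\cos\theta_j^m)^T$, where $\perp$ denotes clockwise rotation by $90$ degrees. In the scheme, $\partial_s$ denotes differentiation with respect to the arclength of $\Gamma^m$: $\partial_sf=|\partial_\rho\vec X^m|^{-1}\partial_\rho f$ (elementwise). The mass-lumped inner product is $$(\vec u,\vec v)_{\Gamma^m}^h=\frac12\sum_{j=1}^J|\vec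 h_j^m|\left[(\vec u\cdot\vec v)(\rho_j^-)+(\vec u\cdot\vec v)(\rho_{j-1}^+)\right],$$ with one-sided limits at the nodes (and the same for scalar functions). The initial data $(\vec X^0,\mu^0,\kappa^0)\in\mathbb X^h\times\mathbb K^h\times\mathbb K_0^h$ are given. *)

theory Defs
  imports "HOL-Analysis.Analysis"
begin

definition C2 :: "(real \<Rightarrow> real) \<Rightarrow> bool" where
  "C2 f \<longleftrightarrow> (\<forall>x. f differentiable (at x)) \<and> (\<forall>x. deriv f differentiable (at x))
     \<and> continuous_on UNIV (deriv (deriv f))"

definition dir :: "real \<Rightarrow> real^2" where
  "dir t = vector [cos t, sin t]"

definition refl_mat :: "real \<Rightarrow> real^2^2" where
  "refl_mat t = vector [vector [cos (2*t), sin (2*t)], vector [sin (2*t), - cos (2*t)]]"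

text \<open>The matrix power with exponent \<open>1 - q\<close> is the iterated matrix product \<open>**\<close>;
  it is the identity for \<open>q = 1\<close>.\<close>

definition B_mat :: "nat \<Rightarrow> (real \<Rightarrow> real) \<Rightarrow> (real \<Rightarrow> real) \<Rightarrow> real \<Rightarrow> real^2^2" where
  "B_mat q \<gamma> S t =
     vector [vector [\<gamma> t, - deriv \<gamma> t], vector [deriv \<gamma> t, \<gamma> t]]
       ** (((**) (refl_mat t)) ^^ (1 - q)) (mat 1)
     + S t *\<^sub>R ((1/2) *\<^sub>R mat 1 - (1/2) *\<^sub>R refl_mat t)"

definition P_fun :: "(real \<Rightarrow> real) \<Rightarrow> real \<Rightarrow> real \<Rightarrow> real \<Rightarrow> real" where
  "P_fun \<gamma> \<alpha> t t' = 2 * sqrt ((\<gamma> t + \<alpha> * (- sin t' * cos t + cos t' * sin t)\<^sup>2) * \<gamma> t)"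

definition Q_fun :: "(real \<Rightarrow> real) \<Rightarrow> real \<Rightarrow> real \<Rightarrow> real" where
  "Q_fun \<gamma> t t' = \<gamma> t' + \<gamma> t * (sin t * sin t' + cos t * cos t')
     + deriv \<gamma> t * (- sin t' * cos t + cos t' * sin t)"

text \<open>The admissible values of the stability function at the angle \<open>t\<close>.  In the first case the
  inequality involves the stability function only through its value \<open>s\<close> at \<open>t\<close>, so it is
  expressed with the constant function \<open>s\<close>.\<close>

definition stab_values :: "nat \<Rightarrow> (real \<Rightarrow> real) \<Rightarrow> real \<Rightarrow> real set" where
  "stab_values q \<gamma> t =
     (if q = 0
      then {s. \<forall>t'\<in>{-pi..pi}. (\<gamma> t *\<^sub>R (B_mat 0 \<gamma> (\<lambda>_. s) t *v dir t')) \<bullet> dir t' \<ge> (\<gamma> t')\<^sup>2}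
      else {\<alpha>. \<alpha> \<ge> 0 \<and> (\<forall>t'\<in>{-pi..pi}. P_fun \<gamma> \<alpha> t t' - Q_fun \<gamma> t t' \<ge> 0)})"

text \<open>The infimum of reals is meaningful only for nonempty sets that are bounded below, which is
  therefore stated separately wherever the function is claimed to be well defined.\<close>

definition min_stab :: "nat \<Rightarrow> (real \<Rightarrow> real) \<Rightarrow> real \<Rightarrow> real" where
  "min_stab q \<gamma> t = Inf (stab_values q \<gamma> t)"

definition min_stab_well_defined :: "nat \<Rightarrow> (real \<Rightarrow> real) \<Rightarrow> bool" where
  "min_stab_well_defined q \<gamma> \<longleftrightarrow>
     (\<forall>t\<in>{-pi..pi}. stab_values q \<gamma> t \<noteq> {} \<and> bdd_below (stab_values q \<gamma> t))"

definition node :: "nat \<Rightarrow> nat \<Rightarrow> real" where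
  "node J j = real j * (1 / real J)"

definition fe_space :: "nat \<Rightarrow> (real \<Rightarrow> real) set" where
  "fe_space J = {u. continuous_on {0..1} u \<and>
     (\<forall>j\<in>{1..J}. \<exists>a b. \<forall>\<rho>\<in>{node J (j - 1)..node J j}. u \<rho> = a + b * \<rho>)}"

definition fe_space0 :: "nat \<Rightarrow> (real \<Rightarrow> real) set" where
  "fe_space0 J = {u \<in> fe_space J. u 0 = 0 \<and> u 1 = 0}"

definition curve_space :: "nat \<Rightarrow> (real \<Rightarrow> real^2) set" where
  "curve_space J = {X. (\<lambda>\<rho>. X \<rho> $ 1) \<in> fe_space J \<and> (\<lambda>\<rho>. X \<rho> $ 2) \<in> fe_space0 J}"

text \<open>Clockwise rotation by 90 degrees.\<close>

definition perp :: "real^2 \<Rightarrow> real^2" where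
  "perp v = vector [v $ 2, - (v $ 1)]"

definition edge :: "nat \<Rightarrow> (real \<Rightarrow> real^2) \<Rightarrow> nat \<Rightarrow> real^2" where
  "edge J X j = X (node J j) - X (node J (j - 1))"

text \<open>The elementwise functions below (tangent angle, normal, derivatives) matter only in the
  interior of the elements: the lumped inner product uses one-sided limits at the nodes.
  For a point \<open>\<rho>\<close> in the interior of the \<open>j\<close>-th element, \<open>elem J \<rho> = j\<close>.\<close>

definition elem :: "nat \<Rightarrow> real \<Rightarrow> nat" where
  "elem J \<rho> = nat \<lceil>real J * \<rho>\<rceil>"

definition normal :: "nat \<Rightarrow> (real \<Rightarrow> real^2) \<Rightarrow> real \<Rightarrow> real^2" where
  "normal J X \<rho> = - ((1 / norm (edge J X (elem J \<rho>))) *\<^sub>R perp (edge J X (elem J \<rho>)))"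

definition is_tangent_angle :: "nat \<Rightarrow> (real \<Rightarrow> real^2) \<Rightarrow> (nat \<Rightarrow> real) \<Rightarrow> bool" where
  "is_tangent_angle J X \<theta> \<longleftrightarrow>
     (\<forall>j\<in>{1..J}. \<theta> j \<in> {-pi..pi} \<and> (1 / norm (edge J X j)) *\<^sub>R edge J X j = dir (\<theta> j))"

definition d_rho :: "(real \<Rightarrow> 'a::real_normed_vector) \<Rightarrow> real \<Rightarrow> 'a" where
  "d_rho f \<rho> = vector_derivative f (at \<rho>)"

text \<open>The arclength is always that of the curve \<open>X\<close>, also when another curve is differentiated.\<close>

definition d_s :: "(real \<Rightarrow> real^2) \<Rightarrow> (real \<Rightarrow> 'a::real_normed_vector) \<Rightarrow> real \<Rightarrow> 'a" where
  "d_s X f \<rho> = (1 / norm (d_rho X \<rho>)) *\<^sub>R d_rho f \<rho>"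

definition half_normal :: "(real \<Rightarrow> real^2) \<Rightarrow> (real \<Rightarrow> real^2) \<Rightarrow> real \<Rightarrow> real^2" where
  "half_normal X X' \<rho> = - ((1/2) *\<^sub>R perp (d_s X X \<rho> + d_s X X' \<rho>))"

definition lumped ::
  "nat \<Rightarrow> (real \<Rightarrow> real^2) \<Rightarrow> (real \<Rightarrow> 'a::real_inner) \<Rightarrow> (real \<Rightarrow> 'a) \<Rightarrow> real" where
  "lumped J X u v = 1/2 * (\<Sum>j=1..J. norm (edge J X j) *
     (Lim (at_left (node J j)) (\<lambda>\<rho>. u \<rho> \<bullet> v \<rho>)
      + Lim (at_right (node J (j - 1))) (\<lambda>\<rho>. u \<rho> \<bullet> v \<rho>)))"

text \<open>One time step: \<open>X, \<kappa>\<close> with tangent angles \<open>\<theta>\<close> are the data at the old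
  time level, \<open>X', \<mu>', \<kappa>'\<close> are the unknowns at the new one
  (\<open>\<mu>\<close> at the old time level does not enter).\<close>

definition scheme_step ::
  "nat \<Rightarrow> (real \<Rightarrow> real) \<Rightarrow> (real \<Rightarrow> real) \<Rightarrow> real \<Rightarrow> real \<Rightarrow> real \<Rightarrow> real \<Rightarrow> nat
   \<Rightarrow> (nat \<Rightarrow> real) \<Rightarrow> (real \<Rightarrow> real^2) \<Rightarrow> (real \<Rightarrow> real)
   \<Rightarrow> (real \<Rightarrow> real^2) \<Rightarrow> (real \<Rightarrow> real) \<Rightarrow> (real \<Rightarrow> real) \<Rightarrow> bool" where
  "scheme_step q \<gamma> S \<epsilon> \<eta> \<sigma> dt J \<theta> X \<kappa> X' \<mu>' \<kappa>' \<longleftrightarrow>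
    (\<forall>\<phi>\<in>fe_space J.
       lumped J X (\<lambda>\<rho>. ((1/dt) *\<^sub>R (X' \<rho> - X \<rho>)) \<bullet> half_normal X X' \<rho>) \<phi>
       + lumped J X (d_s X \<mu>') (d_s X \<phi>) = 0)
    \<and> (\<forall>\<omega>\<in>curve_space J.
       lumped J X \<mu>' (\<lambda>\<rho>. half_normal X X' \<rho> \<bullet> \<omega> \<rho>)
       - lumped J X (\<lambda>\<rho>. B_mat q \<gamma> S (\<theta> (elem J \<rho>)) *v d_s X X' \<rho>) (d_s X \<omega>)
       - \<epsilon>\<^sup>2 * lumped J X
           (\<lambda>\<rho>. d_s X \<kappa>' \<rho> *\<^sub>R normal J X \<rho> - (1/2 * (\<kappa>' \<rho>)\<^sup>2) *\<^sub>R d_s X X' \<rho>) (d_s X \<omega>)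
       - 1/\<eta> * ((X' 0 $ 1 - X 0 $ 1) / dt * \<omega> 0 $ 1 + (X' 1 $ 1 - X 1 $ 1) / dt * \<omega> 1 $ 1)
       + \<sigma> * (\<omega> 1 $ 1 - \<omega> 0 $ 1) = 0)
    \<and> (\<forall>\<phi>\<in>fe_space0 J.
       lumped J X (\<lambda>\<rho>. (\<kappa>' \<rho> - \<kappa> \<rho>) / dt) \<phi>
       - lumped J X (\<lambda>\<rho>. normal J X \<rho> \<bullet> d_s X (\<lambda>r. (1/dt) *\<^sub>R (X' r - X r)) \<rho>) (d_s X \<phi>)
       + lumped J X (\<lambda>\<rho>. (d_s X X' \<rho> \<bullet> d_s X (\<lambda>r. (1/dt) *\<^sub>R (X' r - X r)) \<rho>) * \<kappa>' \<rho>) \<phi> = 0)"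

definition area :: "nat \<Rightarrow> (real \<Rightarrow> real^2) \<Rightarrow> real" where
  "area J X = 1/2 * (\<Sum>j=1..J.
     (X (node J j) $ 1 - X (node J (j - 1)) $ 1) * (X (node J j) $ 2 + X (node J (j - 1)) $ 2))"

definition energy ::
  "(real \<Rightarrow> real) \<Rightarrow> real \<Rightarrow> real \<Rightarrow> nat \<Rightarrow> (nat \<Rightarrow> real) \<Rightarrow> (real \<Rightarrow> real^2) \<Rightarrow> (real \<Rightarrow> real) \<Rightarrow> real" where
  "energy \<gamma> \<epsilon> \<sigma> J \<theta> X \<kappa> =
     (\<Sum>j=1..J. norm (edge J X j) * \<gamma> (\<theta> j))
     + \<epsilon>\<^sup>2 / 4 * (\<Sum>j=1..J. norm (edge J X j) * ((\<kappa> (node J (j - 1)))\<^sup>2 + (\<kappa> (node J j))\<^sup>2))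
     - \<sigma> * (X 1 $ 1 - X 0 $ 1)"

end

theory Submission
  imports Defs
begin

text \<open>
  Area conservation is an algebraic identity.  The normal in the scheme is built from the average of
  the old and the new edge, and for this choice the mass balance tested with a constant is exactly
  the increment of the polygonal area per time step (\<open>area_diff_eq\<close>); the remainder telescopes to
  boundary terms that vanish since the contact points lie on the axis.

  For the energy, the three equations are tested with the new chemical potential, the velocity and
  the new curvature.  After cancellation and after dropping the dissipation this gives a discrete
  energy law (\<open>discrete_energy_law\<close>), in which the increments of the energy are replaced by the
  terms that the implicit scheme produces.  Two local inequalities compare those terms with the true
  increments.  The curvature part is a pair of completed squares (\<open>curvature_node_estimate\<close>).  The
  anisotropic part (\<open>anisotropic_edge_estimate\<close>) is what the stability function is designed for:
  its admissible values are those for which the stabilized matrix controls the change of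
  \<open>length * \<gamma>\<close> on a single edge, by symmetry and positive semidefiniteness for \<open>q = 0\<close> and by the
  inequality of arithmetic and geometric means for \<open>q = 1\<close>.  These values form a closed
  upward ray (\<open>ge_min_stab_imp_stab_value\<close>), so every stability function above the infimum is
  admissible.

  Admissible values exist by Taylor's formula.  The quantity that must be
  dominated by a multiple of \<open>(sin (u - t))\<^sup>2\<close> vanishes to second order at \<open>u = t\<close>; at \<open>u = t + pi\<close> it
  vanishes to second order because of the symmetry of \<open>\<gamma>\<close> if \<open>q = 0\<close>, and it is negative because
  of \<open>\<gamma> (pi + t) < 3 * \<gamma> t\<close> if \<open>q = 1\<close>.  Hence a multiple of \<open>(sin (u - t))\<^sup>2\<close> suffices
  (\<open>bounded_by_sin_squared\<close>).
\<close>

section \<open>Domination of periodic functions by the squared sine\<close>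

text \<open>The third-order remainder of \<open>sin\<close> is at most \<open>\<bar>x\<bar>\<^sup>3 / 6\<close>, which is at most \<open>\<bar>x\<bar> / 2\<close> because
  \<open>(pi/2)\<^sup>2 < 3\<close>.  This turns bounds by \<open>(x - a)\<^sup>2\<close> into bounds by \<open>(sin (x - a))\<^sup>2\<close>.\<close>

lemma abs_sin_ge_half:
  fixes x :: real
  assumes "\<bar>x\<bar> \<le> pi / 2"
  shows "\<bar>x\<bar> / 2 \<le> \<bar>sin x\<bar>"
proof -
  have "\<bar>sin x - (\<Sum>m<3. sin_coeff m * x ^ m)\<bar> \<le> inverse (fact 3) * \<bar>x\<bar> ^ 3"
    by (rule Maclaurin_sin_bound)
  moreover have "(\<Sum>m<3. sin_coeff m * x ^ m) = x"
    by (simp add: sin_coeff_def eval_nat_numeral)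
  moreover have "inverse (fact 3) * \<bar>x\<bar> ^ 3 \<le> \<bar>x\<bar> / 2"
  proof -
    have "\<bar>x\<bar> \<le> 8/5" using assms pi_approx by simp
    hence "\<bar>x\<bar> ^ 2 \<le> (8/5) ^ 2" by (intro power_mono) auto
    hence "\<bar>x\<bar> ^ 2 \<le> 3" by (simp add: power2_eq_square)
    hence "\<bar>x\<bar> * \<bar>x\<bar> ^ 2 \<le> \<bar>x\<bar> * 3" by (intro mult_left_mono) auto
    thus ?thesis by (simp add: fact_numeral power3_eq_cube power2_eq_square)
  qed
  ultimately have "\<bar>sin x - x\<bar> \<le> \<bar>x\<bar> / 2" by linarith
  thus ?thesis by linarith
qed

text \<open>Second-order Taylor expansion at \<open>a\<close>.  When \<open>f a = 0\<close> the first-order term vanishes and only the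
  quadratic remainder is left; when \<open>f a < 0\<close> the first-order term may be present, but completing
  the square trades it against the negative constant.\<close>

lemma quadratic_upper_bound_near_zero:
  fixes f f' f'' :: "real \<Rightarrow> real"
  assumes f: "\<And>x. (f has_real_derivative f' x) (at x)"
    and f': "\<And>x. (f' has_real_derivative f'' x) (at x)"
    and cont: "continuous_on UNIV f''"
    and le: "f a \<le> 0" and eq: "f a = 0 \<Longrightarrow> f' a = 0"
  obtains C where "C \<ge> 0" and "\<And>x. \<bar>x - a\<bar> \<le> pi / 2 \<Longrightarrow> f x \<le> C * (x - a)\<^sup>2"
proof -
  have "bounded (f'' ` {a - pi/2..a + pi/2})"
    by (intro compact_imp_bounded compact_continuous_image continuous_on_subset[OF cont]) auto
  then obtain M where M: "\<And>t. t \<in> {a - pi/2..a + pi/2} \<Longrightarrow> \<bar>f'' t\<bar> \<le> M"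
    unfolding bounded_iff by (metis imageI real_norm_def)
  have M0: "0 \<le> M" using M[of a] by auto
  have taylor: "f x \<le> f a + f' a * (x - a) + M / 2 * (x - a)\<^sup>2" if x: "\<bar>x - a\<bar> \<le> pi / 2" for x
  proof (cases "x = a")
    case False
    define D :: "nat \<Rightarrow> real \<Rightarrow> real" where "D = (\<lambda>n. if n = 0 then f else if n = 1 then f' else f'')"
    have "\<exists>t. (if x < a then x < t \<and> t < a else a < t \<and> t < x) \<and>
      f x = (\<Sum>m<2. (D m a / fact m) * (x - a) ^ m) + (D 2 t / fact 2) * (x - a) ^ 2"
      by (rule Taylor[where a = "a - pi/2" and b = "a + pi/2"])
         (use x f f' False abs_le_D1[OF x] abs_le_D2[OF x] in \<open>auto simp: D_def less_2_cases_iff\<close>)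
    then obtain t where t: "if x < a then x < t \<and> t < a else a < t \<and> t < x"
      and fx: "f x = f a + f' a * (x - a) + f'' t / 2 * (x - a)\<^sup>2"
      by (auto simp: D_def eval_nat_numeral)
    have "f'' t \<le> M" using M[of t] t x by (auto split: if_splits simp: abs_le_iff)
    hence "f'' t / 2 * (x - a)\<^sup>2 \<le> M / 2 * (x - a)\<^sup>2" by (intro mult_right_mono) auto
    with fx show ?thesis by linarith
  qed auto
  show ?thesis
  proof (cases "f a = 0")
    case True
    with eq taylor M0 show ?thesis by (intro that[of "M / 2"]) auto
  next
    case False
    define d where "d = - f a"
    have d: "d > 0" using False le by (simp add: d_def)
    have lin: "f' a * y - d \<le> (f' a)\<^sup>2 / (4 * d) * y\<^sup>2" for y
    proof -
      have "0 \<le> (f' a * y / 2 - d)\<^sup>2 / d" using d by simp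
      also have "\<dots> = (f' a)\<^sup>2 / (4 * d) * y\<^sup>2 - (f' a * y - d)"
        using d by (simp add: power2_eq_square field_simps)
      finally show ?thesis by simp
    qed
    show ?thesis
    proof (rule that[of "M / 2 + (f' a)\<^sup>2 / (4 * d)"])
      show "0 \<le> M / 2 + (f' a)\<^sup>2 / (4 * d)" using M0 d by simp
      fix x assume "\<bar>x - a\<bar> \<le> pi / 2"
      from taylor[OF this] lin[of "x - a"]
      show "f x \<le> (M / 2 + (f' a)\<^sup>2 / (4 * d)) * (x - a)\<^sup>2"
        unfolding distrib_right d_def by linarith
    qed
  qed
qed

text \<open>The function \<open>sin (x - t)\<close> vanishes exactly at \<open>t\<close> and \<open>t + pi\<close> modulo the period, so these are
  the only places where the bound can fail for large \<open>C\<close>.  The two half-period neighbourhoods of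
  these points cover a full period, and the quadratic bound applies on each of them.  The case
  \<open>f t = 0\<close>, \<open>f (t + pi) < 0\<close> occurs for \<open>q = 1\<close>, the case of two zeros for \<open>q = 0\<close>.\<close>

lemma bounded_by_sin_squared:
  fixes f f' f'' :: "real \<Rightarrow> real"
  assumes f: "\<And>x. (f has_real_derivative f' x) (at x)"
    and f': "\<And>x. (f' has_real_derivative f'' x) (at x)"
    and cont: "continuous_on UNIV f''"
    and per: "\<And>x. f (x + 2 * pi) = f x"
    and at_t: "f t \<le> 0" "f t = 0 \<Longrightarrow> f' t = 0"
    and at_opp: "f (t + pi) \<le> 0" "f (t + pi) = 0 \<Longrightarrow> f' (t + pi) = 0"
  obtains C where "C \<ge> 0" and "\<And>x. f x \<le> C * (sin (x - t))\<^sup>2"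
proof -
  obtain C where C: "C \<ge> 0" "\<And>x. \<bar>x - t\<bar> \<le> pi / 2 \<Longrightarrow> f x \<le> C * (x - t)\<^sup>2"
    using quadratic_upper_bound_near_zero[OF f f' cont at_t] by metis
  obtain D where D: "D \<ge> 0" "\<And>x. \<bar>x - (t + pi)\<bar> \<le> pi / 2 \<Longrightarrow> f x \<le> D * (x - (t + pi))\<^sup>2"
    using quadratic_upper_bound_near_zero[OF f f' cont at_opp] by metis
  have sq: "y\<^sup>2 \<le> 4 * (sin y)\<^sup>2" if "\<bar>y\<bar> \<le> pi / 2" for y :: real
  proof -
    have "(\<bar>y\<bar> / 2)\<^sup>2 \<le> \<bar>sin y\<bar>\<^sup>2" by (intro power_mono abs_sin_ge_half that) auto
    thus ?thesis by (simp add: power2_eq_square)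
  qed
  have quadratic_to_sin: "f x \<le> 4 * (C + D) * (sin (x - t))\<^sup>2"
    if "f x \<le> E * (x - b)\<^sup>2" "\<bar>x - b\<bar> \<le> pi / 2" "0 \<le> E" "E \<le> C + D"
       "(sin (x - b))\<^sup>2 = (sin (x - t))\<^sup>2" for E b x
  proof -
    have "E * (x - b)\<^sup>2 \<le> (C + D) * (4 * (sin (x - b))\<^sup>2)"
      using sq[OF that(2)] that C D by (intro mult_mono) auto
    with that show ?thesis by (simp add: algebra_simps)
  qed
  have base: "f x \<le> 4 * (C + D) * (sin (x - t))\<^sup>2"
    if "t - pi / 2 \<le> x" "x \<le> t + 3 * pi / 2" for x
  proof (cases "x \<le> t + pi / 2")
    case True
    hence x: "\<bar>x - t\<bar> \<le> pi / 2" using that by (intro abs_leI) auto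
    show ?thesis using C D x by (intro quadratic_to_sin[OF C(2)[OF x] x]) auto
  next
    case False
    have "(sin (x - (t + pi)))\<^sup>2 = (sin (x - t))\<^sup>2" by (simp add: sin_diff sin_add cos_add power2_eq_square algebra_simps)
    moreover have x: "\<bar>x - (t + pi)\<bar> \<le> pi / 2" using that False by (intro abs_leI) auto
    ultimately show ?thesis using C D by (intro quadratic_to_sin[OF D(2)[OF x] x]) auto
  qed
  interpret f: periodic_fun_simple f "2 * pi" by unfold_locales (rule per)
  interpret s: periodic_fun_simple "\<lambda>x. sin (x - t)" "2 * pi"
    by unfold_locales (metis add_diff_eq diff_add_eq sin_periodic)
  show ?thesis
  proof (rule that[of "4 * (C + D)"])
    show "0 \<le> 4 * (C + D)" using C D by simp
    fix x
    define k where "k = \<lfloor>(x - (t - pi / 2)) / (2 * pi)\<rfloor>"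
    define y where "y = x - of_int k * (2 * pi)"
    have "of_int k \<le> (x - (t - pi / 2)) / (2 * pi)" "(x - (t - pi / 2)) / (2 * pi) \<le> of_int k + 1"
      unfolding k_def by linarith+
    hence "t - pi / 2 \<le> y" "y \<le> t + 3 * pi / 2"
      by (simp_all add: y_def field_simps)
    from base[OF this] show "f x \<le> 4 * (C + D) * (sin (x - t))\<^sup>2"
      unfolding y_def using f.minus_of_int[of x k] s.minus_of_int[of x k] by simp
  qed
qed

section \<open>Admissible values of the stability function\<close>

lemma C2_has_derivatives:
  assumes "C2 g"
  shows "(g has_real_derivative deriv g x) (at x)"
    and "(deriv g has_real_derivative deriv (deriv g) x) (at x)"
    and "continuous_on UNIV (deriv (deriv g))"
  using assms by (auto simp: C2_def DERIV_deriv_iff_real_differentiable)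

lemma deriv_shift_eq:
  fixes g :: "real \<Rightarrow> real"
  assumes "\<And>x. (g has_real_derivative deriv g x) (at x)" and "\<And>x. g (p + x) = g x"
  shows "deriv g (p + x) = deriv g x"
proof -
  have "((\<lambda>x. g (p + x)) has_real_derivative deriv g (p + x)) (at x)"
    using assms(1)[of "p + x"] DERIV_shift[of g "deriv g (p + x)" x p] by (simp add: add.commute)
  hence "(g has_real_derivative deriv g (p + x)) (at x)" using assms(2) by simp
  thus ?thesis by (metis DERIV_imp_deriv)
qed

lemma inner_real2: "(v::real^2) \<bullet> w = v $ 1 * w $ 1 + v $ 2 * w $ 2"
  by (simp add: inner_vec_def sum_2)

text \<open>The matrix multiplied by the stability function is the orthogonal projection onto the normal
  \<open>(- sin t, cos t)\<close> of the edge with angle \<open>t\<close>.  Stabilization therefore leaves tangential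
  vectors alone and adds \<open>S t\<close> times the square of the normal component to the quadratic form.\<close>

lemma normal_projection_inner:
  "(((1/2) *\<^sub>R mat 1 - (1/2) *\<^sub>R refl_mat t) *v v) \<bullet> w =
     (cos t * v $ 2 - sin t * v $ 1) * (cos t * w $ 2 - sin t * w $ 1)"
proof -
  have h: "cos (2*t) = 1 - 2 * (sin t * sin t)" "cos t * cos t = 1 - sin t * sin t"
    using cos_double_sin[of t] sin_cos_squared_add[of t] by (simp_all add: power2_eq_square)
  have "(((1/2) *\<^sub>R mat 1 - (1/2) *\<^sub>R refl_mat t) *v v) \<bullet> w =
     (sin t * sin t) * v $ 1 * w $ 1 - sin t * cos t * (v $ 1 * w $ 2 + v $ 2 * w $ 1)
     + (1 - sin t * sin t) * v $ 2 * w $ 2"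
    by (simp add: refl_mat_def inner_real2 matrix_vector_mult_def sum_2 mat_def h(1) sin_double)
      (simp add: field_simps)
  also have "\<dots> = (cos t * v $ 2 - sin t * v $ 1) * (cos t * w $ 2 - sin t * w $ 1)"
    unfolding h(2)[symmetric] by (simp add: algebra_simps)
  finally show ?thesis .
qed

lemma B_mat_inner_split:
  "(B_mat q \<gamma> S t *v v) \<bullet> w =
     ((vector [vector [\<gamma> t, - deriv \<gamma> t], vector [deriv \<gamma> t, \<gamma> t]]
       ** (((**) (refl_mat t)) ^^ (1 - q)) (mat 1)) *v v) \<bullet> w
     + S t * ((cos t * v $ 2 - sin t * v $ 1) * (cos t * w $ 2 - sin t * w $ 1))"
  unfolding B_mat_def matrix_vector_mult_add_rdistrib inner_add_left
    scaleR_matrix_vector_assoc[symmetric] inner_scaleR_left normal_projection_inner ..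

text \<open>The right-hand side is symmetric in \<open>v\<close> and \<open>w\<close>: the reflection symmetrizes the matrix built from
  \<open>\<gamma> t\<close> and \<open>deriv \<gamma> t\<close>.  The energy estimate for \<open>q = 0\<close> rests on this symmetry.\<close>

lemma B_mat_0_inner:
  "(B_mat 0 \<gamma> S t *v v) \<bullet> w =
     (\<gamma> t * cos (2*t) - deriv \<gamma> t * sin (2*t)) * (v $ 1 * w $ 1 - v $ 2 * w $ 2)
     + (\<gamma> t * sin (2*t) + deriv \<gamma> t * cos (2*t)) * (v $ 1 * w $ 2 + v $ 2 * w $ 1)
     + S t * ((cos t * v $ 2 - sin t * v $ 1) * (cos t * w $ 2 - sin t * w $ 1))"
  unfolding B_mat_inner_split
  by (simp add: refl_mat_def inner_real2 matrix_vector_mult_def matrix_matrix_mult_def sum_2 mat_def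
      algebra_simps)

lemma B_mat_1_inner:
  "(B_mat 1 \<gamma> S t *v v) \<bullet> w =
     \<gamma> t * (v \<bullet> w) + deriv \<gamma> t * (v $ 1 * w $ 2 - v $ 2 * w $ 1)
     + S t * ((cos t * v $ 2 - sin t * v $ 1) * (cos t * w $ 2 - sin t * w $ 1))"
  unfolding B_mat_inner_split
  by (simp add: inner_real2 matrix_vector_mult_def matrix_matrix_mult_def sum_2 mat_def
      algebra_simps)

lemma B_mat_0_dir_quadratic:
  "(B_mat 0 \<gamma> S t *v dir u) \<bullet> dir u =
     \<gamma> t * cos (2 * (u - t)) + deriv \<gamma> t * sin (2 * (u - t)) + S t * (sin (u - t))\<^sup>2"
proof -
  have "cos (2 * (u - t)) = cos (2*u) * cos (2*t) + sin (2*u) * sin (2*t)"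
    "sin (2 * (u - t)) = sin (2*u) * cos (2*t) - cos (2*u) * sin (2*t)"
    unfolding right_diff_distrib cos_diff sin_diff by simp_all
  moreover have "cos (2*u) = cos u * cos u - sin u * sin u" "sin (2*u) = 2 * sin u * cos u"
    by (simp_all add: cos_double sin_double power2_eq_square)
  moreover have "S t * ((cos t * sin u - sin t * cos u) * (cos t * sin u - sin t * cos u)) =
      S t * (sin (u - t))\<^sup>2"
    unfolding sin_diff by (simp add: power2_eq_square algebra_simps)
  ultimately show ?thesis
    by (simp only: B_mat_0_inner dir_def vector_2) (simp only: algebra_simps)
qed

lemma stab_values_0_iff:
  "s \<in> stab_values 0 \<gamma> t \<longleftrightarrow> (\<forall>u\<in>{-pi..pi}. (\<gamma> u)\<^sup>2 \<le>
     \<gamma> t * (\<gamma> t * cos (2 * (u - t)) + deriv \<gamma> t * sin (2 * (u - t)) + s * (sin (u - t))\<^sup>2))"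
  by (simp add: stab_values_def B_mat_0_dir_quadratic)

lemma stab_values_1_iff:
  "\<alpha> \<in> stab_values 1 \<gamma> t \<longleftrightarrow> \<alpha> \<ge> 0 \<and> (\<forall>u\<in>{-pi..pi}.
     Q_fun \<gamma> t u \<le> 2 * sqrt ((\<gamma> t + \<alpha> * (sin (u - t))\<^sup>2) * \<gamma> t))"
proof -
  have "(- sin u * cos t + cos u * sin t)\<^sup>2 = (sin (u - t))\<^sup>2" for u
    unfolding sin_diff by (simp add: power2_eq_square algebra_simps)
  thus ?thesis by (simp add: stab_values_def P_fun_def)
qed

lemma Q_fun_eq: "Q_fun \<gamma> t u = \<gamma> u + \<gamma> t * cos (u - t) - deriv \<gamma> t * sin (u - t)"
  unfolding Q_fun_def sin_diff cos_diff by (simp add: algebra_simps)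

text \<open>The inequality to be achieved says that
  \<open>f x = (\<gamma> x)\<^sup>2 - \<gamma> t * (\<gamma> t * cos (2 * (x - t)) + deriv \<gamma> t * sin (2 * (x - t)))\<close> is at most
  \<open>\<gamma> t * s * (sin (x - t))\<^sup>2\<close>.  Here \<open>f\<close> vanishes to second order at \<open>t\<close>, and, as \<open>\<gamma>\<close> has period
  \<open>pi\<close>, also at \<open>t + pi\<close>.\<close>

lemma stab_values_0_nonempty:
  assumes C2: "C2 \<gamma>" and pos: "\<gamma> t > 0" and per: "\<And>x. \<gamma> (pi + x) = \<gamma> x"
  shows "stab_values 0 \<gamma> t \<noteq> {}"
proof -
  note d = C2_has_derivatives[OF C2]
  define f where "f = (\<lambda>x. (\<gamma> x)\<^sup>2 - \<gamma> t * (\<gamma> t * cos (2 * (x - t)) + deriv \<gamma> t * sin (2 * (x - t))))"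
  define f' where "f' = (\<lambda>x. 2 * \<gamma> x * deriv \<gamma> x
    - \<gamma> t * (2 * deriv \<gamma> t * cos (2 * (x - t)) - 2 * \<gamma> t * sin (2 * (x - t))))"
  define f'' where "f'' = (\<lambda>x. 2 * deriv \<gamma> x * deriv \<gamma> x + 2 * \<gamma> x * deriv (deriv \<gamma>) x
    - \<gamma> t * (- 4 * deriv \<gamma> t * sin (2 * (x - t)) - 4 * \<gamma> t * cos (2 * (x - t))))"
  have f: "(f has_real_derivative f' x) (at x)" for x
    unfolding f_def f'_def by (auto intro!: derivative_eq_intros d simp: algebra_simps)
  have f': "(f' has_real_derivative f'' x) (at x)" for x
    unfolding f'_def f''_def by (auto intro!: derivative_eq_intros d simp: algebra_simps)
  have cont: "continuous_on UNIV f''"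
    unfolding f''_def
    by (intro continuous_intros d(3) DERIV_continuous_on[OF DERIV_subset[OF d(1)]]
        DERIV_continuous_on[OF DERIV_subset[OF d(2)]]) auto
  have per_f: "f (x + pi) = f x" for x
  proof -
    have shift: "2 * (x + pi - t) = 2 * (x - t) + 2 * pi" by simp
    show ?thesis unfolding f_def shift cos_periodic sin_periodic using per[of x] by (simp add: add.commute)
  qed
  have "f t = 0" "f' t = 0" by (simp_all add: f_def f'_def power2_eq_square)
  moreover have "f (t + pi) = 0" using per_f \<open>f t = 0\<close> by simp
  moreover have "f' (t + pi) = 0"
    using per[of t] deriv_shift_eq[OF d(1) per, of t] by (simp add: f'_def add.commute)
  moreover have "f (x + 2 * pi) = f x" for x
    using per_f[of x] per_f[of "x + pi"] by (simp add: add.assoc)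
  ultimately obtain C where C: "\<And>x. f x \<le> C * (sin (x - t))\<^sup>2"
    using bounded_by_sin_squared[OF f f' cont, of t] by (metis order_refl)
  have "C / \<gamma> t \<in> stab_values 0 \<gamma> t"
    unfolding stab_values_0_iff using C pos by (simp add: f_def algebra_simps)
  thus ?thesis by blast
qed

text \<open>At an angle at distance \<open>pi / 2\<close> from \<open>t\<close> the defining inequality reads
  \<open>(\<gamma> u)\<^sup>2 \<le> \<gamma> t * (s - \<gamma> t)\<close>.\<close>

lemma stab_values_0_nonneg:
  assumes pos: "\<gamma> t > 0" and t: "t \<in> {-pi..pi}" and s: "s \<in> stab_values 0 \<gamma> t"
  shows "0 \<le> s"
proof -
  define u where "u = (if t \<le> 0 then t + pi / 2 else t - pi / 2)"
  have u: "u \<in> {-pi..pi}" using t by (auto simp: u_def)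
  have "2 * (u - t) = pi \<or> 2 * (u - t) = - pi" by (simp add: u_def)
  hence "cos (2 * (u - t)) = -1" "sin (2 * (u - t)) = 0" by auto
  moreover have "(sin (u - t))\<^sup>2 = 1" by (simp add: u_def)
  ultimately have "(\<gamma> u)\<^sup>2 \<le> \<gamma> t * (s - \<gamma> t)"
    using s u unfolding stab_values_0_iff by fastforce
  hence "0 \<le> \<gamma> t * (s - \<gamma> t)" by (meson order_trans zero_le_power2)
  thus ?thesis using pos by (simp add: zero_le_mult_iff)
qed

text \<open>Let \<open>f x = Q_fun \<gamma> t x - 2 * \<gamma> t\<close>.  It vanishes to second order at \<open>t\<close>, and
  \<open>f (t + pi) = \<gamma> (t + pi) - 3 * \<gamma> t\<close> is negative: this is the place where the bound on the
  asymmetry of \<open>\<gamma>\<close> enters.  Hence \<open>Q_fun \<gamma> t x \<le> 2 * \<gamma> t + C * (sin (x - t))\<^sup>2\<close>, and the square root in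
  \<open>P_fun\<close> dominates the right-hand side once \<open>\<alpha>\<close> is large.\<close>

lemma stab_values_1_nonempty:
  assumes C2: "C2 \<gamma>" and pos: "\<gamma> t > 0" and per: "\<And>x. \<gamma> (x + 2 * pi) = \<gamma> x"
    and opp: "\<gamma> (pi + t) < 3 * \<gamma> t"
  shows "stab_values 1 \<gamma> t \<noteq> {}"
proof -
  note d = C2_has_derivatives[OF C2]
  define f where "f = (\<lambda>x. \<gamma> x + \<gamma> t * cos (x - t) - deriv \<gamma> t * sin (x - t) - 2 * \<gamma> t)"
  define f' where "f' = (\<lambda>x. deriv \<gamma> x - \<gamma> t * sin (x - t) - deriv \<gamma> t * cos (x - t))"
  define f'' where "f'' = (\<lambda>x. deriv (deriv \<gamma>) x - \<gamma> t * cos (x - t) + deriv \<gamma> t * sin (x - t))"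
  have f: "(f has_real_derivative f' x) (at x)" for x
    unfolding f_def f'_def by (auto intro!: derivative_eq_intros d simp: algebra_simps)
  have f': "(f' has_real_derivative f'' x) (at x)" for x
    unfolding f'_def f''_def by (auto intro!: derivative_eq_intros d simp: algebra_simps)
  have cont: "continuous_on UNIV f''"
    unfolding f''_def by (intro continuous_intros d(3))
  have per_f: "f (x + 2 * pi) = f x" for x
  proof -
    have shift: "x + 2 * pi - t = x - t + 2 * pi" by simp
    show ?thesis unfolding f_def shift cos_periodic sin_periodic per ..
  qed
  have "f t = 0" "f' t = 0" by (simp_all add: f_def f'_def)
  moreover have "f (t + pi) < 0" using opp by (simp add: f_def add.commute)
  ultimately obtain C where C0: "C \<ge> 0" and C: "\<And>x. f x \<le> C * (sin (x - t))\<^sup>2"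
    using bounded_by_sin_squared[OF f f' cont per_f, of t] by (metis less_le order_refl)
  (* chosen so that the square root dominates: for 0 <= z <= 1,
     (\<gamma> t + C z / 2)^2 <= (\<gamma> t)^2 + \<alpha> (\<gamma> t) z *)
  define \<alpha> where "\<alpha> = C + C\<^sup>2 / (4 * \<gamma> t)"
  have "\<alpha> \<in> stab_values 1 \<gamma> t"
    unfolding stab_values_1_iff
  proof (intro conjI ballI)
    show "0 \<le> \<alpha>" using C0 pos by (simp add: \<alpha>_def)
    fix u
    define z where "z = (sin (u - t))\<^sup>2"
    have z: "0 \<le> z" "z \<le> 1" by (simp_all add: z_def abs_square_le_1)
    have "(\<gamma> t + C * z / 2)\<^sup>2 = (\<gamma> t)\<^sup>2 + \<gamma> t * C * z + C\<^sup>2 / 4 * (z * z)"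
      by (simp add: power2_eq_square field_simps)
    also have "\<dots> \<le> (\<gamma> t)\<^sup>2 + \<gamma> t * C * z + C\<^sup>2 / 4 * z"
      using z by (intro add_left_mono mult_left_mono) (auto simp: mult_left_le)
    also have "\<dots> = (\<gamma> t + \<alpha> * z) * \<gamma> t"
      using pos by (simp add: \<alpha>_def power2_eq_square field_simps)
    finally have "2 * (\<gamma> t + C * z / 2) \<le> 2 * sqrt ((\<gamma> t + \<alpha> * z) * \<gamma> t)"
      by (intro mult_left_mono real_le_rsqrt) auto
    moreover have "Q_fun \<gamma> t u \<le> 2 * (\<gamma> t + C * z / 2)"
      using C[of u] by (simp add: Q_fun_eq f_def z_def)
    ultimately show "Q_fun \<gamma> t u \<le> 2 * sqrt ((\<gamma> t + \<alpha> * (sin (u - t))\<^sup>2) * \<gamma> t)"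
      unfolding z_def by (rule order_trans[rotated])
  qed
  thus ?thesis by blast
qed

text \<open>The admissible values form an upward closed set, because the stabilization term is monotone in the
  stability value, and a topologically closed set, because each defining inequality is continuous in
  it.  Such a set contains everything from its infimum on.\<close>

lemma ge_min_stab_imp_stab_value:
  assumes q: "q \<in> {0, 1}" and pos: "\<gamma> t > 0"
    and ne: "stab_values q \<gamma> t \<noteq> {}"
    and ge: "s \<ge> min_stab q \<gamma> t"
  shows "s \<in> stab_values q \<gamma> t"
proof -
  have up: "r + e \<in> stab_values q \<gamma> t" if "r \<in> stab_values q \<gamma> t" "e \<ge> 0" for r e
  proof -
    have mono: "r * (sin x)\<^sup>2 \<le> (r + e) * (sin x)\<^sup>2" for x
      using that by (intro mult_right_mono) auto
    show ?thesis
    proof (cases "q = 0")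
      case True
      show ?thesis
        unfolding True stab_values_0_iff
      proof
        fix u assume "u \<in> {-pi..pi}"
        with that(1) have "(\<gamma> u)\<^sup>2 \<le> \<gamma> t * (\<gamma> t * cos (2 * (u - t)) + deriv \<gamma> t * sin (2 * (u - t))
            + r * (sin (u - t))\<^sup>2)"
          unfolding True stab_values_0_iff by blast
        also have "\<dots> \<le> \<gamma> t * (\<gamma> t * cos (2 * (u - t)) + deriv \<gamma> t * sin (2 * (u - t))
            + (r + e) * (sin (u - t))\<^sup>2)"
          using pos by (intro mult_left_mono add_left_mono mono) auto
        finally show "(\<gamma> u)\<^sup>2 \<le> \<dots>" .
      qed
    next
      case False
      hence q1: "q = 1" using q by simp
      have nonneg: "0 \<le> r" using that(1) unfolding q1 stab_values_1_iff by blast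
      show ?thesis
        unfolding q1 stab_values_1_iff
      proof (intro conjI ballI)
        show "0 \<le> r + e" using nonneg that(2) by simp
        fix u assume "u \<in> {-pi..pi}"
        with that(1) have "Q_fun \<gamma> t u \<le> 2 * sqrt ((\<gamma> t + r * (sin (u - t))\<^sup>2) * \<gamma> t)"
          unfolding q1 stab_values_1_iff by blast
        also have "\<dots> \<le> 2 * sqrt ((\<gamma> t + (r + e) * (sin (u - t))\<^sup>2) * \<gamma> t)"
          using pos by (intro mult_left_mono real_sqrt_le_mono mult_right_mono add_left_mono mono) auto
        finally show "Q_fun \<gamma> t u \<le> \<dots>" .
      qed
    qed
  qed
  have above: "s + e \<in> stab_values q \<gamma> t" if "e > 0" for e
  proof -
    have "min_stab q \<gamma> t < s + e" using ge that by simp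
    then obtain r where r: "r \<in> stab_values q \<gamma> t" "r < s + e"
      using cInf_lessD[OF ne] unfolding min_stab_def by blast
    show ?thesis using up[OF r(1), of "s + e - r"] r(2) by simp
  qed
  (* closedness: the admissible values s + 1 / (n + 1) converge to s *)
  have lim: "(\<lambda>n. s + 1 / real (Suc n)) \<longlonglongrightarrow> s + 0"
    by (intro tendsto_intros LIMSEQ_Suc[OF lim_1_over_n])
  have seq: "s + 1 / real (Suc n) \<in> stab_values q \<gamma> t" for n by (rule above) simp
  show ?thesis
  proof (cases "q = 0")
    case True
    show ?thesis
      unfolding True stab_values_0_iff
    proof
      fix u assume u: "u \<in> {-pi..pi}"
      have "(\<lambda>n. \<gamma> t * (\<gamma> t * cos (2 * (u - t)) + deriv \<gamma> t * sin (2 * (u - t))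
          + (s + 1 / real (Suc n)) * (sin (u - t))\<^sup>2))
        \<longlonglongrightarrow> \<gamma> t * (\<gamma> t * cos (2 * (u - t)) + deriv \<gamma> t * sin (2 * (u - t))
          + (s + 0) * (sin (u - t))\<^sup>2)"
        by (intro tendsto_intros lim)
      from LIMSEQ_le_const[OF this] seq u
      show "(\<gamma> u)\<^sup>2 \<le> \<gamma> t * (\<gamma> t * cos (2 * (u - t)) + deriv \<gamma> t * sin (2 * (u - t))
          + s * (sin (u - t))\<^sup>2)"
        unfolding True stab_values_0_iff by auto
    qed
  next
    case False
    hence q1: "q = 1" using q by simp
    show ?thesis
      unfolding q1 stab_values_1_iff
    proof (intro conjI ballI)
      show "0 \<le> s"
        using LIMSEQ_le_const[OF lim, of 0] seq unfolding q1 stab_values_1_iff by auto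
      fix u assume u: "u \<in> {-pi..pi}"
      have "(\<lambda>n. 2 * sqrt ((\<gamma> t + (s + 1 / real (Suc n)) * (sin (u - t))\<^sup>2) * \<gamma> t))
        \<longlonglongrightarrow> 2 * sqrt ((\<gamma> t + (s + 0) * (sin (u - t))\<^sup>2) * \<gamma> t)"
        by (intro tendsto_intros lim)
      from LIMSEQ_le_const[OF this] seq u
      show "Q_fun \<gamma> t u \<le> 2 * sqrt ((\<gamma> t + s * (sin (u - t))\<^sup>2) * \<gamma> t)"
        unfolding q1 stab_values_1_iff by auto
    qed
  qed
qed

section \<open>Anisotropic estimate on a single edge\<close>

lemma polar_form:
  obtains r \<phi> where "(v::real^2) = r *\<^sub>R dir \<phi>" and "\<phi> \<in> {-pi..pi}"
proof
  define z where "z = Complex (v $ 1) (v $ 2)"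
  have "rcis (cmod z) (Arg z) = z" by (rule rcis_cmod_Arg)
  hence "v $ 1 = cmod z * cos (Arg z)" "v $ 2 = cmod z * sin (Arg z)"
    by (metis Re_rcis z_def complex.sel(1)) (metis \<open>rcis (cmod z) (Arg z) = z\<close> Im_rcis z_def complex.sel(2))
  thus "v = cmod z *\<^sub>R dir (Arg z)" by (simp add: vec_eq_iff forall_2 dir_def)
  show "Arg z \<in> {-pi..pi}" using Arg_bounded[of z] by auto
qed

text \<open>The local inequality behind the energy decay: \<open>L, t\<close> and \<open>L', u\<close> are length and angle of an edge
  before and after the step.

  For \<open>q = 0\<close> the stability inequality makes the quadratic form of the matrix positive
  semidefinite, since it is bounded below by \<open>(\<gamma> u)\<^sup>2 / \<gamma> t\<close> on unit vectors.  For a symmetric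
  positive semidefinite form \<open>b\<close> one has \<open>b v (v - w) \<ge> (b v v - b w w) / 2\<close>.  With
  \<open>b w w = L\<^sup>2 * \<gamma> t\<close> and \<open>b v v \<ge> L'\<^sup>2 * (\<gamma> u)\<^sup>2 / \<gamma> t\<close> the claim becomes
  \<open>(L' * \<gamma> u - L * \<gamma> t)\<^sup>2 \<ge> 0\<close>.

  For \<open>q = 1\<close> the form is not symmetric.  Here \<open>Q_fun \<gamma> t u\<close> is \<open>\<gamma> u\<close> plus the mixed term of the
  form at the two unit tangents, and \<open>P_fun \<gamma> (S t) t u\<close> is twice the geometric mean of the values of
  the quadratic form at them, so the condition \<open>P_fun \<ge> Q_fun\<close> combines with the inequality of
  arithmetic and geometric means.\<close>

lemma anisotropic_edge_estimate:
  assumes q: "q \<in> {0, 1}" and pos: "\<gamma> t > 0" and u: "u \<in> {-pi..pi}"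
    and S: "S t \<in> stab_values q \<gamma> t" and L: "L > 0" "L' > 0"
  shows "L' * \<gamma> u - L * \<gamma> t
    \<le> (B_mat q \<gamma> S t *v (L' *\<^sub>R dir u)) \<bullet> (L' *\<^sub>R dir u - L *\<^sub>R dir t) / L"
proof -
  define b where "b v w = (B_mat q \<gamma> S t *v v) \<bullet> w" for v w
  define k where "k = b (dir u) (dir t)"
  have b_scale: "b (r *\<^sub>R v) w = r * b v w" "b v (r *\<^sub>R w) = r * b v w" for r v w
    by (simp_all add: b_def matrix_vector_mult_scaleR)
  have b_diff: "b (v - v') w = b v w - b v' w" "b v (w - w') = b v w - b v w'" for v v' w w'
    by (simp_all add: b_def matrix_vector_mult_diff_distrib inner_diff_left inner_diff_right)
  have lin: "b (L' *\<^sub>R dir u) (L' *\<^sub>R dir u - L *\<^sub>R dir t) = L'\<^sup>2 * b (dir u) (dir u) - L' * L * k"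
    by (simp add: b_diff b_scale k_def power2_eq_square algebra_simps)
  have "L * (L' * \<gamma> u - L * \<gamma> t) \<le> b (L' *\<^sub>R dir u) (L' *\<^sub>R dir u - L *\<^sub>R dir t)"
  proof (cases "q = 0")
    case True
    have stab: "(\<gamma> x)\<^sup>2 \<le> \<gamma> t * b (dir x) (dir x)" if "x \<in> {-pi..pi}" for x
      using S that unfolding True b_def B_mat_0_dir_quadratic stab_values_0_iff by auto
    have psd: "0 \<le> b v v" for v
    proof -
      obtain r \<phi> where v: "v = r *\<^sub>R dir \<phi>" "\<phi> \<in> {-pi..pi}" by (rule polar_form)
      have "0 \<le> \<gamma> t * b (dir \<phi>) (dir \<phi>)" using stab[OF v(2)] by (meson order_trans zero_le_power2)
      hence "0 \<le> b (dir \<phi>) (dir \<phi>)" using pos by (simp add: zero_le_mult_iff)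
      hence "0 \<le> (r * r) * b (dir \<phi>) (dir \<phi>)" by (rule mult_nonneg_nonneg[OF zero_le_square])
      thus ?thesis by (simp add: v(1) b_scale mult.assoc)
    qed
    have btt: "b (dir t) (dir t) = \<gamma> t"
      unfolding b_def True B_mat_0_dir_quadratic by simp
    have sym: "b (dir t) (dir u) = k"
      unfolding b_def k_def True B_mat_0_inner by (simp add: algebra_simps)
    have "0 \<le> b (L' *\<^sub>R dir u - L *\<^sub>R dir t) (L' *\<^sub>R dir u - L *\<^sub>R dir t)" by (rule psd)
    also have "\<dots> = L'\<^sup>2 * b (dir u) (dir u) - 2 * L' * L * k + L\<^sup>2 * \<gamma> t"
      by (simp add: b_diff b_scale btt sym k_def[symmetric] power2_eq_square algebra_simps)
    finally have 1: "2 * L' * L * k \<le> L'\<^sup>2 * b (dir u) (dir u) + L\<^sup>2 * \<gamma> t" by simp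
    have "0 \<le> (L' * \<gamma> u - L * \<gamma> t)\<^sup>2" by simp
    also have "\<dots> = L'\<^sup>2 * (\<gamma> u)\<^sup>2 - \<gamma> t * (2 * L * L' * \<gamma> u - L\<^sup>2 * \<gamma> t)"
      by (simp add: power2_eq_square algebra_simps)
    also have "\<dots> \<le> L'\<^sup>2 * (\<gamma> t * b (dir u) (dir u)) - \<gamma> t * (2 * L * L' * \<gamma> u - L\<^sup>2 * \<gamma> t)"
      using stab[OF u] by (intro diff_right_mono mult_left_mono) auto
    also have "\<dots> = \<gamma> t * (L'\<^sup>2 * b (dir u) (dir u) - 2 * L * L' * \<gamma> u + L\<^sup>2 * \<gamma> t)"
      by (simp add: algebra_simps)
    finally have "0 \<le> L'\<^sup>2 * b (dir u) (dir u) - 2 * L * L' * \<gamma> u + L\<^sup>2 * \<gamma> t"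
      using pos by (simp add: zero_le_mult_iff)
    with 1 show ?thesis unfolding lin by (simp add: power2_eq_square algebra_simps)
  next
    case False
    hence q1: "q = 1" using q by simp
    define p where "p = \<gamma> t + S t * (sin (u - t))\<^sup>2"
    (* p is the value of the quadratic form at the new unit tangent *)
    have S': "0 \<le> S t" and stab: "Q_fun \<gamma> t u \<le> 2 * sqrt (p * \<gamma> t)"
      using S u unfolding q1 stab_values_1_iff p_def by auto
    have p: "p > 0" using pos S' by (simp add: p_def add_pos_nonneg)
    have "cos u * cos u + sin u * sin u = 1"
      using sin_cos_squared_add3 by blast
    hence buu: "b (dir u) (dir u) = p"
      unfolding b_def q1 B_mat_1_inner p_def sin_diff
      by (simp add: dir_def inner_real2 power2_eq_square) (simp add: algebra_simps)
    have "Q_fun \<gamma> t u = \<gamma> u + k"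
      unfolding k_def b_def q1 B_mat_1_inner Q_fun_def
      by (simp add: dir_def inner_real2 algebra_simps)
    with stab have k: "k \<le> 2 * (sqrt p * sqrt (\<gamma> t)) - \<gamma> u" by (simp add: real_sqrt_mult)
    have "L * (L' * \<gamma> u - L * \<gamma> t) \<le> L * (L' * \<gamma> u - L * \<gamma> t) + (L' * sqrt p - L * sqrt (\<gamma> t))\<^sup>2"
      by simp
    also have "\<dots> = L'\<^sup>2 * (sqrt p)\<^sup>2 - L' * L * (2 * (sqrt p * sqrt (\<gamma> t)) - \<gamma> u)
         + L\<^sup>2 * ((sqrt (\<gamma> t))\<^sup>2 - \<gamma> t)"
      by (simp add: power2_eq_square algebra_simps)
    also have "\<dots> \<le> L'\<^sup>2 * p - L' * L * k"
      using mult_left_mono[OF k, of "L' * L"] L p pos by simp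
    finally show ?thesis unfolding lin buu .
  qed
  thus ?thesis using L by (simp add: b_def pos_le_divide_eq mult.commute)
qed

section \<open>Elementwise affine functions and the lumped inner product\<close>

text \<open>A vector-valued counterpart of \<open>fe_space\<close>, so that scalar finite element functions and curves can be
  differentiated by the same lemmas.\<close>

definition elementwise_affine :: "nat \<Rightarrow> (real \<Rightarrow> 'a::real_normed_vector) \<Rightarrow> bool" where
  "elementwise_affine J u \<longleftrightarrow> continuous_on {0..1} u \<and>
     (\<forall>j\<in>{1..J}. \<exists>a b. \<forall>\<rho>\<in>{node J (j - 1)..node J j}. u \<rho> = a + \<rho> *\<^sub>R b)"

lemma elementwise_affineE:
  assumes "elementwise_affine J u" and "j \<in> {1..J}"
  obtains a b where "\<forall>\<rho>\<in>{node J (j - 1)..node J j}. u \<rho> = a + \<rho> *\<^sub>R b"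
  using assms unfolding elementwise_affine_def by blast

lemma fe_space_iff_elementwise_affine: "u \<in> fe_space J \<longleftrightarrow> elementwise_affine J u"
  by (simp add: fe_space_def elementwise_affine_def mult.commute)

lemma curve_space_imp_elementwise_affine:
  assumes "X \<in> curve_space J"
  shows "elementwise_affine J X"
proof -
  have c: "elementwise_affine J (\<lambda>\<rho>. X \<rho> $ 1)" "elementwise_affine J (\<lambda>\<rho>. X \<rho> $ 2)"
    using assms by (auto simp: curve_space_def fe_space0_def fe_space_iff_elementwise_affine)
  have "continuous_on {0..1} (\<lambda>\<rho>. X \<rho> $ i)" for i
  proof -
    have "i = 1 \<or> i = 2" by (rule exhaust_2)
    thus ?thesis using c unfolding elementwise_affine_def by (elim disjE) simp_all
  qed
  hence "continuous_on {0..1} (\<lambda>\<rho>. \<chi> i. X \<rho> $ i)"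
    by (rule continuous_on_vec_lambda)
  moreover have "\<exists>a b. \<forall>\<rho>\<in>{node J (j - 1)..node J j}. X \<rho> = a + \<rho> *\<^sub>R b" if j: "j \<in> {1..J}" for j
  proof -
    obtain a b where 1: "\<forall>\<rho>\<in>{node J (j - 1)..node J j}. X \<rho> $ 1 = a + \<rho> *\<^sub>R b"
      by (rule elementwise_affineE[OF c(1) j])
    obtain c d where 2: "\<forall>\<rho>\<in>{node J (j - 1)..node J j}. X \<rho> $ 2 = c + \<rho> *\<^sub>R d"
      by (rule elementwise_affineE[OF c(2) j])
    have "\<forall>\<rho>\<in>{node J (j - 1)..node J j}. X \<rho> = vector [a, c] + \<rho> *\<^sub>R vector [b, d]"
      unfolding vec_eq_iff forall_2 using 1 2 by simp
    thus ?thesis by (intro exI)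
  qed
  ultimately show ?thesis unfolding elementwise_affine_def vec_lambda_eta by (intro conjI ballI)
qed

lemma elementwise_affine_scaled_diff:
  assumes "elementwise_affine J u" and "elementwise_affine J u'"
  shows "elementwise_affine J (\<lambda>\<rho>. r *\<^sub>R (u' \<rho> - u \<rho>))"
  unfolding elementwise_affine_def
proof (intro conjI ballI)
  show "continuous_on {0..1} (\<lambda>\<rho>. r *\<^sub>R (u' \<rho> - u \<rho>))"
    using assms unfolding elementwise_affine_def by (intro continuous_intros) blast+
  fix j assume j: "j \<in> {1..J}"
  obtain a b where 1: "\<forall>\<rho>\<in>{node J (j - 1)..node J j}. u \<rho> = a + \<rho> *\<^sub>R b"
    by (rule elementwise_affineE[OF assms(1) j])
  obtain c d where 2: "\<forall>\<rho>\<in>{node J (j - 1)..node J j}. u' \<rho> = c + \<rho> *\<^sub>R d"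
    by (rule elementwise_affineE[OF assms(2) j])
  have "\<forall>\<rho>\<in>{node J (j - 1)..node J j}. r *\<^sub>R (u' \<rho> - u \<rho>) = r *\<^sub>R (c - a) + \<rho> *\<^sub>R (r *\<^sub>R (d - b))"
    using 1 2 by (simp add: algebra_simps)
  thus "\<exists>a b. \<forall>\<rho>\<in>{node J (j - 1)..node J j}. r *\<^sub>R (u' \<rho> - u \<rho>) = a + \<rho> *\<^sub>R b" by (intro exI)
qed

lemma curve_space_scaled_diff:
  assumes "X \<in> curve_space J" and "X' \<in> curve_space J"
  shows "(\<lambda>\<rho>. r *\<^sub>R (X' \<rho> - X \<rho>)) \<in> curve_space J"
proof -
  have "elementwise_affine J (\<lambda>\<rho>. r *\<^sub>R (X' \<rho> $ i - X \<rho> $ i))" for i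
    using assms exhaust_2[of i]
    by (intro elementwise_affine_scaled_diff)
      (auto simp: curve_space_def fe_space0_def fe_space_iff_elementwise_affine)
  hence "(\<lambda>\<rho>. (r *\<^sub>R (X' \<rho> - X \<rho>)) $ i) \<in> fe_space J" for i
    unfolding fe_space_iff_elementwise_affine vector_scaleR_component vector_minus_component .
  moreover have "X 0 $ 2 = 0" "X' 0 $ 2 = 0" "X 1 $ 2 = 0" "X' 1 $ 2 = 0"
    using assms by (auto simp: curve_space_def fe_space0_def)
  ultimately show ?thesis
    unfolding curve_space_def fe_space0_def mem_Collect_eq by simp
qed

lemma node_less: "j \<in> {1..J} \<Longrightarrow> node J (j - 1) < node J j"
  by (auto simp: node_def divide_strict_right_mono)

lemma node_bounds: "j \<le> J \<Longrightarrow> 0 \<le> node J j \<and> node J j \<le> 1"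
  by (auto simp: node_def divide_le_eq_1)

lemma element_subset: "j \<in> {1..J} \<Longrightarrow> {node J (j - 1)..node J j} \<subseteq> {0..1}"
  using node_bounds[of j J] node_bounds[of "j - 1" J] by auto

lemma elementwise_affine_continuous:
  assumes "elementwise_affine J u" and "j \<in> {1..J}"
  shows "continuous_on {node J (j - 1)..node J j} u"
proof (rule continuous_on_subset)
  show "continuous_on {0..1} u" using assms(1) by (simp add: elementwise_affine_def)
  show "{node J (j - 1)..node J j} \<subseteq> {0..1}" by (rule element_subset[OF assms(2)])
qed

lemma elem_interior:
  assumes "j \<in> {1..J}" and "\<rho> \<in> {node J (j - 1)<..<node J j}"
  shows "elem J \<rho> = j"
proof -
  have "\<lceil>real J * \<rho>\<rceil> = int j"
    using assms by (intro ceiling_unique) (auto simp: node_def field_simps of_nat_diff)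
  thus ?thesis by (simp add: elem_def)
qed

lemma d_rho_elementwise_affine:
  assumes "elementwise_affine J u" and j: "j \<in> {1..J}" and \<rho>: "\<rho> \<in> {node J (j - 1)<..<node J j}"
  shows "d_rho u \<rho> = real J *\<^sub>R (u (node J j) - u (node J (j - 1)))"
proof -
  obtain a b where ab: "\<forall>\<rho>\<in>{node J (j - 1)..node J j}. u \<rho> = a + \<rho> *\<^sub>R b"
    by (rule elementwise_affineE[OF assms(1) j])
  have "((\<lambda>\<rho>. a + \<rho> *\<^sub>R b) has_vector_derivative b) (at \<rho>)"
    by (auto intro!: derivative_eq_intros)
  hence "(u has_vector_derivative b) (at \<rho>)"
    by (rule has_vector_derivative_transform_within_open[where S = "{node J (j - 1)<..<node J j}"])
      (use ab \<rho> in auto)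
  hence "d_rho u \<rho> = b" by (simp add: d_rho_def vector_derivative_at)
  moreover have "u (node J j) - u (node J (j - 1)) = (node J j - node J (j - 1)) *\<^sub>R b"
    using ab node_less[OF j] by (simp add: algebra_simps)
  moreover have "real J * (node J j - node J (j - 1)) = 1"
    using j by (simp add: node_def of_nat_diff field_simps)
  ultimately show ?thesis by simp
qed

lemma d_s_elementwise_affine:
  assumes "elementwise_affine J X" and "elementwise_affine J u"
    and j: "j \<in> {1..J}" and "\<rho> \<in> {node J (j - 1)<..<node J j}"
  shows "d_s X u \<rho> = (1 / norm (edge J X j)) *\<^sub>R (u (node J j) - u (node J (j - 1)))"
proof -
  have "d_rho X \<rho> = real J *\<^sub>R edge J X j"
    unfolding edge_def by (rule d_rho_elementwise_affine[OF assms(1) j assms(4)])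
  moreover have "d_rho u \<rho> = real J *\<^sub>R (u (node J j) - u (node J (j - 1)))"
    by (rule d_rho_elementwise_affine[OF assms(2) j assms(4)])
  ultimately show ?thesis using j by (simp add: d_s_def)
qed

lemma d_s_curve:
  assumes "elementwise_affine J X" and "elementwise_affine J Y"
    and "j \<in> {1..J}" and "\<rho> \<in> {node J (j - 1)<..<node J j}"
  shows "d_s X Y \<rho> = (1 / norm (edge J X j)) *\<^sub>R edge J Y j"
  using d_s_elementwise_affine[OF assms] by (simp only: edge_def)

text \<open>On the open element the integrand is known in closed form, possibly with a different formula \<open>G j\<close>
  on each element; its one-sided limits at the nodes are the values of the continuous \<open>G j\<close> there.
  All terms of the scheme are evaluated in this way.\<close>

lemma lumped_eq_nodal_sum:
  assumes cont: "\<And>j. j \<in> {1..J} \<Longrightarrow> continuous_on {node J (j - 1)..node J j} (G j)"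
    and eq: "\<And>j \<rho>. j \<in> {1..J} \<Longrightarrow> \<rho> \<in> {node J (j - 1)<..<node J j} \<Longrightarrow> u \<rho> \<bullet> v \<rho> = G j \<rho>"
  shows "lumped J X u v =
    1/2 * (\<Sum>j=1..J. norm (edge J X j) * (G j (node J j) + G j (node J (j - 1))))"
proof -
  have "Lim (at_left (node J j)) (\<lambda>\<rho>. u \<rho> \<bullet> v \<rho>) = G j (node J j)
    \<and> Lim (at_right (node J (j - 1))) (\<lambda>\<rho>. u \<rho> \<bullet> v \<rho>) = G j (node J (j - 1))"
    if j: "j \<in> {1..J}" for j
  proof (intro conjI tendsto_Lim)
    note less = node_less[OF j]
    have "eventually (\<lambda>\<rho>. G j \<rho> = u \<rho> \<bullet> v \<rho>) (at_left (node J j))"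
      using eq[OF j] less by (intro eventually_at_leftI) auto
    thus "((\<lambda>\<rho>. u \<rho> \<bullet> v \<rho>) \<longlongrightarrow> G j (node J j)) (at_left (node J j))"
      by (rule Lim_transform_eventually[OF continuous_on_Icc_at_leftD[OF cont[OF j] less]])
    have "eventually (\<lambda>\<rho>. G j \<rho> = u \<rho> \<bullet> v \<rho>) (at_right (node J (j - 1)))"
      using eq[OF j] less by (intro eventually_at_rightI) auto
    thus "((\<lambda>\<rho>. u \<rho> \<bullet> v \<rho>) \<longlongrightarrow> G j (node J (j - 1))) (at_right (node J (j - 1)))"
      by (rule Lim_transform_eventually[OF continuous_on_Icc_at_rightD[OF cont[OF j] less]])
  qed auto
  thus ?thesis by (simp add: lumped_def)
qed

lemma lumped_cong:
  assumes "\<And>\<rho>. u \<rho> \<bullet> v \<rho> = u' \<rho> \<bullet> v' \<rho>"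
  shows "lumped J X u v = lumped J X u' v'"
  unfolding lumped_def assms ..

section \<open>Conservation of area\<close>

lemma perp_scaleR: "perp (r *\<^sub>R v) = r *\<^sub>R perp v"
  by (simp add: perp_def vec_eq_iff forall_2)

lemma half_normal_elementwise:
  assumes "elementwise_affine J X" and "elementwise_affine J X'"
    and "j \<in> {1..J}" and "\<rho> \<in> {node J (j - 1)<..<node J j}"
  shows "half_normal X X' \<rho> = - ((1 / (2 * norm (edge J X j))) *\<^sub>R perp (edge J X j + edge J X' j))"
  unfolding half_normal_def d_s_curve[OF assms(1) assms(1) assms(3,4)] d_s_curve[OF assms]
    scaleR_add_right[symmetric] perp_scaleR scaleR_scaleR by simp

text \<open>The area is a quadratic form in the nodal coordinates.  Averaging the old and the new edge makes the
  increment of the area exact up to a telescoping term, the nodal increments of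
  \<open>(x' - x) * (y' + y)\<close>, which vanishes because both curves end on the line \<open>y = 0\<close>.  This is the
  reason for the half-step normal in the scheme.\<close>

lemma area_diff_eq:
  assumes "J \<ge> 1" and "X 0 $ 2 = 0" "X 1 $ 2 = 0" "X' 0 $ 2 = 0" "X' 1 $ 2 = 0"
  shows "area J X' - area J X = - (1/4) * (\<Sum>j=1..J.
    ((X' (node J j) - X (node J j)) + (X' (node J (j - 1)) - X (node J (j - 1))))
      \<bullet> perp (edge J X j + edge J X' j))"
proof -
  define T where "T j = (X' (node J j) $ 1 - X (node J j) $ 1) * (X' (node J j) $ 2 + X (node J j) $ 2)" for j
  have ends: "node J J = 1" "node J 0 = 0" using assms(1) by (auto simp: node_def)
  have "(\<Sum>j=1..J. T j - T (j - 1)) = T J - T 0"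
    using sum_telescope''[of 0 J T] by simp
  also have "\<dots> = 0" using assms by (simp add: T_def ends)
  finally have tel: "(\<Sum>j=1..J. T j - T (j - 1)) = 0" .
  have "area J X' - area J X =
    (\<Sum>j=1..J. - (1/4) * (((X' (node J j) - X (node J j)) + (X' (node J (j - 1)) - X (node J (j - 1))))
      \<bullet> perp (edge J X j + edge J X' j)) + 1/2 * (T j - T (j - 1)))"
    unfolding area_def T_def right_diff_distrib[symmetric] sum_subtractf[symmetric] sum_distrib_left
    by (intro sum.cong refl) (simp add: inner_vec_def sum_2 perp_def edge_def field_simps)
  also have "\<dots> = - (1/4) * (\<Sum>j=1..J.
    ((X' (node J j) - X (node J j)) + (X' (node J (j - 1)) - X (node J (j - 1))))
      \<bullet> perp (edge J X j + edge J X' j)) + 1/2 * (\<Sum>j=1..J. T j - T (j - 1))"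
    unfolding sum.distrib sum_distrib_left ..
  finally show ?thesis using tel by simp
qed

text \<open>The constant test function removes the diffusion term from the mass balance, and what is left is
  the increment of the area divided by the time step.\<close>

lemma area_conserved_step:
  assumes J: "J \<ge> 1" and dt: "0 < dt"
    and X: "X \<in> curve_space J" and X': "X' \<in> curve_space J"
    and edges: "\<And>j. j \<in> {1..J} \<Longrightarrow> edge J X j \<noteq> 0"
    and step: "scheme_step q \<gamma> S \<epsilon> \<eta> \<sigma> dt J \<theta> X \<kappa> X' \<mu>' \<kappa>'"
  shows "area J X' = area J X"
proof -
  note aff = curve_space_imp_elementwise_affine[OF X] curve_space_imp_elementwise_affine[OF X']
  have factor: "1/2 * (L * (((1/dt) *\<^sub>R a) \<bullet> (- ((1/(2*L)) *\<^sub>R P)) + ((1/dt) *\<^sub>R b) \<bullet> (- ((1/(2*L)) *\<^sub>R P))))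
      = - (1/4) * ((a + b) \<bullet> P) / dt" if "L \<noteq> 0" for L and a b P :: "real^2"
    using that dt
    by (simp only: inner_scaleR_left inner_scaleR_right inner_minus_right inner_add_left)
      (simp add: field_simps)
  have "\<exists>a b. \<forall>\<rho>\<in>{node J (j - 1)..node J j}. 1 = a + b * \<rho>" for j
    by (rule exI[of _ 1], rule exI[of _ 0]) simp
  hence "(\<lambda>_. 1) \<in> fe_space J"
    unfolding fe_space_def by simp
  hence "lumped J X (\<lambda>\<rho>. ((1/dt) *\<^sub>R (X' \<rho> - X \<rho>)) \<bullet> half_normal X X' \<rho>) (\<lambda>_. 1)
       + lumped J X (d_s X \<mu>') (d_s X (\<lambda>_. 1)) = 0"
    using step unfolding scheme_step_def by blast
  moreover have "lumped J X (d_s X \<mu>') (d_s X (\<lambda>_. 1)) = 0"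
    by (subst lumped_eq_nodal_sum[where G = "\<lambda>_ _. 0"])
      (auto simp: d_s_def d_rho_def)
  moreover have "lumped J X (\<lambda>\<rho>. ((1/dt) *\<^sub>R (X' \<rho> - X \<rho>)) \<bullet> half_normal X X' \<rho>) (\<lambda>_. 1)
     = - (1/4) * (\<Sum>j=1..J. ((X' (node J j) - X (node J j)) + (X' (node J (j - 1)) - X (node J (j - 1))))
      \<bullet> perp (edge J X j + edge J X' j)) / dt"
  proof -
    have "lumped J X (\<lambda>\<rho>. ((1/dt) *\<^sub>R (X' \<rho> - X \<rho>)) \<bullet> half_normal X X' \<rho>) (\<lambda>_. 1) =
      1/2 * (\<Sum>j=1..J. norm (edge J X j) *
        (((1/dt) *\<^sub>R (X' (node J j) - X (node J j))) \<bullet>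
            (- ((1 / (2 * norm (edge J X j))) *\<^sub>R perp (edge J X j + edge J X' j)))
        + ((1/dt) *\<^sub>R (X' (node J (j - 1)) - X (node J (j - 1)))) \<bullet>
            (- ((1 / (2 * norm (edge J X j))) *\<^sub>R perp (edge J X j + edge J X' j)))))"
    proof (rule lumped_eq_nodal_sum, goal_cases)
      case (1 j)
      show ?case by (intro continuous_intros elementwise_affine_continuous[OF _ 1] aff)
    next
      case (2 j \<rho>)
      show ?case unfolding half_normal_elementwise[OF aff 2] by simp
    qed
    also have "\<dots> = - (1/4) * (\<Sum>j=1..J. ((X' (node J j) - X (node J j)) + (X' (node J (j - 1)) - X (node J (j - 1))))
      \<bullet> perp (edge J X j + edge J X' j)) / dt"
      unfolding sum_distrib_left sum_divide_distrib
      by (intro sum.cong refl factor) (simp add: edges)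
    finally show ?thesis .
  qed
  moreover have "area J X' - area J X = - (1/4) * (\<Sum>j=1..J.
      ((X' (node J j) - X (node J j)) + (X' (node J (j - 1)) - X (node J (j - 1))))
        \<bullet> perp (edge J X j + edge J X' j))"
    by (rule area_diff_eq[OF J]) (use X X' in \<open>simp_all add: curve_space_def fe_space0_def\<close>)
  ultimately have "(area J X' - area J X) / dt = 0" by (metis add.right_neutral)
  thus ?thesis using dt by simp
qed

section \<open>Dissipation of energy\<close>

lemma edge_scaled_diff: "edge J (\<lambda>r. c *\<^sub>R (X' r - X r)) j = c *\<^sub>R (edge J X' j - edge J X j)"
  by (simp add: edge_def algebra_simps)

text \<open>The three equations are tested with the new chemical potential, with the velocity \<open>v = (X' - X) / dt\<close>, and
  with the new curvature.  The chemical potential contributes minus a sum of squares and the contact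
  points contribute minus \<open>1/\<eta>\<close> times a sum of squares; both are discarded, which leaves an
  inequality.  The term that couples the derivative of the curvature with the normal velocity
  appears in the second and the third equation with opposite signs and cancels, and half of the
  quadratic curvature term survives.\<close>

lemma discrete_energy_law:
  assumes \<eta>: "0 < \<eta>" and dt: "0 < dt"
    and X: "X \<in> curve_space J" and X': "X' \<in> curve_space J"
    and \<mu>': "\<mu>' \<in> fe_space J" and \<kappa>: "\<kappa> \<in> fe_space0 J" and \<kappa>': "\<kappa>' \<in> fe_space0 J"
    and edges: "\<And>j. j \<in> {1..J} \<Longrightarrow> edge J X j \<noteq> 0"
    and step: "scheme_step q \<gamma> S \<epsilon> \<eta> \<sigma> dt J \<theta> X \<kappa> X' \<mu>' \<kappa>'"
  defines "w \<equiv> \<lambda>j. edge J X' j - edge J X j"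
  shows "(\<Sum>j=1..J. (B_mat q \<gamma> S (\<theta> j) *v edge J X' j) \<bullet> w j / norm (edge J X j))
    + \<epsilon>\<^sup>2 * (\<Sum>j=1..J.
        norm (edge J X j) / 2 * ((\<kappa>' (node J j) - \<kappa> (node J j)) * \<kappa>' (node J j)
          + (\<kappa>' (node J (j - 1)) - \<kappa> (node J (j - 1))) * \<kappa>' (node J (j - 1)))
        + (edge J X' j \<bullet> w j) / (4 * norm (edge J X j))
          * ((\<kappa>' (node J j))\<^sup>2 + (\<kappa>' (node J (j - 1)))\<^sup>2))
    - \<sigma> * ((X' 1 $ 1 - X 1 $ 1) - (X' 0 $ 1 - X 0 $ 1)) \<le> 0"
proof -
  define v where "v = (\<lambda>r. (1/dt) *\<^sub>R (X' r - X r))"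
  define L where "L j = norm (edge J X j)" for j
  have L: "L j > 0" if "j \<in> {1..J}" for j using edges[OF that] by (simp add: L_def)
  have v_space: "v \<in> curve_space J" unfolding v_def by (rule curve_space_scaled_diff[OF X X'])
  have aff: "elementwise_affine J X" "elementwise_affine J X'" "elementwise_affine J v"
    "elementwise_affine J \<mu>'" "elementwise_affine J \<kappa>" "elementwise_affine J \<kappa>'"
    using curve_space_imp_elementwise_affine[OF X] curve_space_imp_elementwise_affine[OF X']
      curve_space_imp_elementwise_affine[OF v_space] \<mu>' \<kappa> \<kappa>'
    by (simp_all add: fe_space0_def fe_space_iff_elementwise_affine)
  note cont = elementwise_affine_continuous[OF aff(5)] elementwise_affine_continuous[OF aff(6)]
  have edge_v: "edge J v j = (1/dt) *\<^sub>R w j" for j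
    unfolding v_def w_def by (rule edge_scaled_diff)

  (* elementwise values: a is the coupling of curvature and normal velocity that cancels in the end,
     b the relative stretching rate, which multiplies the squared curvature *)
  define a where "a j = ((1 / L j) * (\<kappa>' (node J j) - \<kappa>' (node J (j - 1)))) *
    ((- ((1 / L j) *\<^sub>R perp (edge J X j))) \<bullet> ((1 / L j) *\<^sub>R ((1/dt) *\<^sub>R w j)))" for j
  define b where "b j = ((1 / L j) *\<^sub>R edge J X' j) \<bullet> ((1 / L j) *\<^sub>R ((1/dt) *\<^sub>R w j))" for j
  have b: "b j = (edge J X' j \<bullet> w j) / (dt * (L j)\<^sup>2)" for j
    by (simp add: b_def power2_eq_square)

  have dX': "d_s X X' \<rho> = (1 / L j) *\<^sub>R edge J X' j"
    and dv: "d_s X v \<rho> = (1 / L j) *\<^sub>R ((1/dt) *\<^sub>R w j)"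
    and d\<kappa>: "d_s X \<kappa>' \<rho> = (1 / L j) * (\<kappa>' (node J j) - \<kappa>' (node J (j - 1)))"
    and n: "normal J X \<rho> = - ((1 / L j) *\<^sub>R perp (edge J X j))"
    and el: "elem J \<rho> = j"
    if "j \<in> {1..J}" "\<rho> \<in> {node J (j - 1)<..<node J j}" for j \<rho>
    using d_s_curve[OF aff(1,2) that] d_s_curve[OF aff(1,3) that]
      d_s_elementwise_affine[OF aff(1,6) that] elem_interior[OF that]
    by (simp_all only: L_def edge_v normal_def real_scaleR_def)

  define A where "A = lumped J X (\<lambda>\<rho>. B_mat q \<gamma> S (\<theta> (elem J \<rho>)) *v d_s X X' \<rho>) (d_s X v)"
  define C where "C = lumped J X
    (\<lambda>\<rho>. d_s X \<kappa>' \<rho> *\<^sub>R normal J X \<rho> - (1/2 * (\<kappa>' \<rho>)\<^sup>2) *\<^sub>R d_s X X' \<rho>) (d_s X v)"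
  define D where "D = lumped J X (\<lambda>\<rho>. normal J X \<rho> \<bullet> d_s X v \<rho>) (d_s X \<kappa>')"
  define E where "E = lumped J X (\<lambda>\<rho>. (d_s X X' \<rho> \<bullet> d_s X v \<rho>) * \<kappa>' \<rho>) \<kappa>'"
  define F where "F = lumped J X (\<lambda>\<rho>. (\<kappa>' \<rho> - \<kappa> \<rho>) / dt) \<kappa>'"

  have A_eq: "A = (\<Sum>j=1..J. (B_mat q \<gamma> S (\<theta> j) *v edge J X' j) \<bullet> w j / L j) / dt"
  proof -
    have "A = 1/2 * (\<Sum>j=1..J. L j *
       ((B_mat q \<gamma> S (\<theta> j) *v ((1 / L j) *\<^sub>R edge J X' j)) \<bullet> ((1 / L j) *\<^sub>R ((1/dt) *\<^sub>R w j))
      + (B_mat q \<gamma> S (\<theta> j) *v ((1 / L j) *\<^sub>R edge J X' j)) \<bullet> ((1 / L j) *\<^sub>R ((1/dt) *\<^sub>R w j))))"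
      unfolding A_def L_def
      by (rule lumped_eq_nodal_sum)
        (intro continuous_intros, simp only: dX' dv el L_def)
    also have "\<dots> = (\<Sum>j=1..J. (B_mat q \<gamma> S (\<theta> j) *v edge J X' j) \<bullet> w j / L j) / dt"
      unfolding sum_distrib_left sum_divide_distrib
    proof (intro sum.cong refl)
      fix j assume "j \<in> {1..J}"
      from L[OF this] dt show "1/2 * (L j *
       ((B_mat q \<gamma> S (\<theta> j) *v ((1 / L j) *\<^sub>R edge J X' j)) \<bullet> ((1 / L j) *\<^sub>R ((1/dt) *\<^sub>R w j))
      + (B_mat q \<gamma> S (\<theta> j) *v ((1 / L j) *\<^sub>R edge J X' j)) \<bullet> ((1 / L j) *\<^sub>R ((1/dt) *\<^sub>R w j))))
       = (B_mat q \<gamma> S (\<theta> j) *v edge J X' j) \<bullet> w j / L j / dt"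
        by (simp add: matrix_vector_mult_scaleR)
    qed
    finally show ?thesis .
  qed

  have C_eq: "C = 1/2 * (\<Sum>j=1..J. L j *
      ((a j - 1/2 * b j * (\<kappa>' (node J j))\<^sup>2) + (a j - 1/2 * b j * (\<kappa>' (node J (j - 1)))\<^sup>2)))"
    unfolding C_def L_def
  proof (rule lumped_eq_nodal_sum, goal_cases)
    case (1 j)
    show ?case by (intro continuous_intros cont 1)
  next
    case (2 j \<rho>)
    show ?case
      unfolding dX'[OF 2] dv[OF 2] d\<kappa>[OF 2] n[OF 2] a_def b_def inner_diff_left inner_scaleR_left
      by (simp add: mult_ac)
  qed
  have D_eq: "D = 1/2 * (\<Sum>j=1..J. L j * (a j + a j))"
    unfolding D_def L_def
    by (rule lumped_eq_nodal_sum) (intro continuous_intros, simp only: dv d\<kappa> n a_def inner_real_def mult.commute)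
  have E_eq: "E = 1/2 * (\<Sum>j=1..J. L j * (b j * (\<kappa>' (node J j))\<^sup>2 + b j * (\<kappa>' (node J (j - 1)))\<^sup>2))"
    unfolding E_def L_def
  proof (rule lumped_eq_nodal_sum, goal_cases)
    case (1 j)
    show ?case by (intro continuous_intros cont 1)
  next
    case (2 j \<rho>)
    show ?case unfolding dX'[OF 2] dv[OF 2] b_def by (simp add: power2_eq_square)
  qed
  have F_eq: "F = 1/2 * (\<Sum>j=1..J. L j * ((\<kappa>' (node J j) - \<kappa> (node J j)) / dt * \<kappa>' (node J j)
      + (\<kappa>' (node J (j - 1)) - \<kappa> (node J (j - 1))) / dt * \<kappa>' (node J (j - 1))))"
    unfolding F_def L_def
  proof (rule lumped_eq_nodal_sum, goal_cases)
    case (1 j)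
    show ?case using dt by (intro continuous_intros cont 1) auto
  qed simp

  (* first equation, tested with the new chemical potential *)
  have "lumped J X (\<lambda>\<rho>. v \<rho> \<bullet> half_normal X X' \<rho>) \<mu>' + lumped J X (d_s X \<mu>') (d_s X \<mu>') = 0"
    using step \<mu>' unfolding scheme_step_def v_def by blast
  moreover have "0 \<le> lumped J X (d_s X \<mu>') (d_s X \<mu>')"
  proof -
    define g where "g j = (1 / norm (edge J X j)) *\<^sub>R (\<mu>' (node J j) - \<mu>' (node J (j - 1)))" for j
    have "lumped J X (d_s X \<mu>') (d_s X \<mu>') =
      1/2 * (\<Sum>j=1..J. norm (edge J X j) * (g j \<bullet> g j + g j \<bullet> g j))"
      by (rule lumped_eq_nodal_sum)
        (intro continuous_intros, simp only: d_s_elementwise_affine[OF aff(1,4)] g_def)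
    also have "0 \<le> \<dots>" by (intro mult_nonneg_nonneg sum_nonneg add_nonneg_nonneg) auto
    finally show ?thesis .
  qed
  moreover have "lumped J X \<mu>' (\<lambda>\<rho>. half_normal X X' \<rho> \<bullet> v \<rho>)
      = lumped J X (\<lambda>\<rho>. v \<rho> \<bullet> half_normal X X' \<rho>) \<mu>'"
    by (rule lumped_cong) (simp add: inner_commute)
  ultimately have mass: "lumped J X \<mu>' (\<lambda>\<rho>. half_normal X X' \<rho> \<bullet> v \<rho>) \<le> 0" by linarith

  (* second equation, tested with the velocity *)
  have "lumped J X \<mu>' (\<lambda>\<rho>. half_normal X X' \<rho> \<bullet> v \<rho>) - A - \<epsilon>\<^sup>2 * C
       - 1/\<eta> * ((X' 0 $ 1 - X 0 $ 1) / dt * v 0 $ 1 + (X' 1 $ 1 - X 1 $ 1) / dt * v 1 $ 1)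
       + \<sigma> * (v 1 $ 1 - v 0 $ 1) = 0"
    using step v_space unfolding scheme_step_def A_def C_def by blast
  moreover have v1: "v r $ 1 = (X' r $ 1 - X r $ 1) / dt" for r by (simp add: v_def)
  moreover have "0 \<le> 1/\<eta> * ((X' 0 $ 1 - X 0 $ 1) / dt * v 0 $ 1 + (X' 1 $ 1 - X 1 $ 1) / dt * v 1 $ 1)"
    unfolding v1 using \<eta>
    by (intro mult_nonneg_nonneg add_nonneg_nonneg zero_le_square) simp
  ultimately have AC: "A + \<epsilon>\<^sup>2 * C - \<sigma> * (v 1 $ 1 - v 0 $ 1) \<le> 0" using mass by linarith

  (* third equation, tested with the new curvature *)
  have "F - D + E = 0"
    using step \<kappa>' unfolding scheme_step_def D_def E_def F_def v_def by blast
  moreover have "C = D - E / 2"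
    unfolding C_eq D_eq E_eq
    unfolding sum_distrib_left sum_divide_distrib sum_subtractf[symmetric]
    by (intro sum.cong refl) (simp add: field_simps)
  ultimately have "C = F + E / 2" by simp
  also have "\<dots> = (\<Sum>j=1..J.
        L j / 2 * ((\<kappa>' (node J j) - \<kappa> (node J j)) * \<kappa>' (node J j)
          + (\<kappa>' (node J (j - 1)) - \<kappa> (node J (j - 1))) * \<kappa>' (node J (j - 1)))
        + (edge J X' j \<bullet> w j) / (4 * L j)
          * ((\<kappa>' (node J j))\<^sup>2 + (\<kappa>' (node J (j - 1)))\<^sup>2)) / dt" (is "_ = ?C / dt")
  proof -
    have cancel: "1/2 * (l * (x / dt * y + x' / dt * y')) + 1/2 * (1/2 * (l * (p / (dt * l\<^sup>2) * s + p / (dt * l\<^sup>2) * s')))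
       = (l / 2 * (x * y + x' * y') + p / (4 * l) * (s + s')) / dt" if "l > 0"
      for l x y x' y' p s s' :: real
      using that dt by (simp add: field_simps power2_eq_square)
    have "F + E / 2 = (\<Sum>j=1..J. 1/2 * (L j * ((\<kappa>' (node J j) - \<kappa> (node J j)) / dt * \<kappa>' (node J j)
        + (\<kappa>' (node J (j - 1)) - \<kappa> (node J (j - 1))) / dt * \<kappa>' (node J (j - 1))))
        + 1/2 * (1/2 * (L j * (b j * (\<kappa>' (node J j))\<^sup>2 + b j * (\<kappa>' (node J (j - 1)))\<^sup>2))))"
      unfolding F_eq E_eq sum.distrib sum_distrib_left[symmetric] by simp
    also have "\<dots> = ?C / dt"
      unfolding sum_divide_distrib b by (intro sum.cong refl cancel L)
    finally show ?thesis .
  qed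
  finally have C: "C = ?C / dt" .
  have "(\<Sum>j=1..J. (B_mat q \<gamma> S (\<theta> j) *v edge J X' j) \<bullet> w j / L j) + \<epsilon>\<^sup>2 * ?C
      - \<sigma> * ((X' 1 $ 1 - X 1 $ 1) - (X' 0 $ 1 - X 0 $ 1))
    = dt * (A + \<epsilon>\<^sup>2 * C - \<sigma> * (v 1 $ 1 - v 0 $ 1))"
    unfolding A_eq C v1 using dt by (simp add: field_simps)
  also have "\<dots> \<le> 0" using AC dt by (simp add: mult_le_0_iff)
  finally show ?thesis unfolding L_def .
qed

text \<open>After multiplication by \<open>4 * L\<close> the right-hand side exceeds the left-hand side by at least the
  squares of \<open>L * (k' - k)\<close> and \<open>(L' - L) * k'\<close>.  The first accounts for the implicit treatment of
  the curvature, the second for the change of length.\<close>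

lemma curvature_node_estimate:
  fixes k k' L L' p :: real
  assumes L: "0 < L" and p: "L' * (L' - L) \<le> p"
  shows "(L' * k'\<^sup>2 - L * k\<^sup>2) / 4 \<le> L / 2 * ((k' - k) * k') + p / (4 * L) * k'\<^sup>2"
proof -
  have "L * (L' * k'\<^sup>2 - L * k\<^sup>2) \<le> L * (L' * k'\<^sup>2 - L * k\<^sup>2) + (L * (k' - k))\<^sup>2 + ((L' - L) * k')\<^sup>2"
    by simp
  also have "\<dots> = 2 * L\<^sup>2 * ((k' - k) * k') + (L' * (L' - L)) * k'\<^sup>2"
    by (simp add: power2_eq_square algebra_simps)
  also have "\<dots> \<le> 2 * L\<^sup>2 * ((k' - k) * k') + p * k'\<^sup>2"
    using p by (intro add_left_mono mult_right_mono) auto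
  finally show ?thesis using L by (simp add: field_simps power2_eq_square)
qed

lemma norm_dir: "norm (dir t) = 1"
  by (simp add: norm_eq_sqrt_inner inner_real2 dir_def flip: power2_eq_square)

text \<open>By the discrete energy law it suffices to bound the increments of the surface energy and of the
  bending energy from above by the corresponding terms of the law.  This is done edge by edge and,
  for the bending energy, at each of the two nodes of an edge.\<close>

lemma energy_decreasing_step:
  assumes q: "q \<in> {0, 1}" and \<eta>: "0 < \<eta>" and dt: "0 < dt"
    and pos: "\<And>t. 0 < \<gamma> t"
    and S: "\<And>t. t \<in> {-pi..pi} \<Longrightarrow> S t \<in> stab_values q \<gamma> t"
    and X: "X \<in> curve_space J" and X': "X' \<in> curve_space J"
    and \<mu>': "\<mu>' \<in> fe_space J" and \<kappa>: "\<kappa> \<in> fe_space0 J" and \<kappa>': "\<kappa>' \<in> fe_space0 J"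
    and edges: "\<And>j. j \<in> {1..J} \<Longrightarrow> edge J X j \<noteq> 0"
    and edges': "\<And>j. j \<in> {1..J} \<Longrightarrow> edge J X' j \<noteq> 0"
    and \<theta>: "is_tangent_angle J X \<theta>" and \<theta>': "is_tangent_angle J X' \<theta>'"
    and step: "scheme_step q \<gamma> S \<epsilon> \<eta> \<sigma> dt J \<theta> X \<kappa> X' \<mu>' \<kappa>'"
  shows "energy \<gamma> \<epsilon> \<sigma> J \<theta>' X' \<kappa>' \<le> energy \<gamma> \<epsilon> \<sigma> J \<theta> X \<kappa>"
proof -
  define L where "L j = norm (edge J X j)" for j
  define L' where "L' j = norm (edge J X' j)" for j
  define w where "w j = edge J X' j - edge J X j" for j
  have L: "L j > 0" "L' j > 0" if "j \<in> {1..J}" for j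
    using edges[OF that] edges'[OF that] by (simp_all add: L_def L'_def)
  have angles: "\<theta> j \<in> {-pi..pi}" "\<theta>' j \<in> {-pi..pi}"
    and polar: "edge J X j = L j *\<^sub>R dir (\<theta> j)" "edge J X' j = L' j *\<^sub>R dir (\<theta>' j)"
    if j: "j \<in> {1..J}" for j
  proof -
    have "(1 / L j) *\<^sub>R edge J X j = dir (\<theta> j)" "(1 / L' j) *\<^sub>R edge J X' j = dir (\<theta>' j)"
      and "\<theta> j \<in> {-pi..pi}" "\<theta>' j \<in> {-pi..pi}"
      using \<theta> \<theta>' j unfolding is_tangent_angle_def L_def L'_def by blast+
    thus "\<theta> j \<in> {-pi..pi}" "\<theta>' j \<in> {-pi..pi}"
      and "edge J X j = L j *\<^sub>R dir (\<theta> j)" "edge J X' j = L' j *\<^sub>R dir (\<theta>' j)"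
      using L[OF j] by (simp_all flip: \<open>(1 / L j) *\<^sub>R edge J X j = dir (\<theta> j)\<close>
          \<open>(1 / L' j) *\<^sub>R edge J X' j = dir (\<theta>' j)\<close>)
  qed
  have surface: "(\<Sum>j=1..J. L' j * \<gamma> (\<theta>' j)) - (\<Sum>j=1..J. L j * \<gamma> (\<theta> j))
      \<le> (\<Sum>j=1..J. (B_mat q \<gamma> S (\<theta> j) *v edge J X' j) \<bullet> w j / L j)"
    unfolding sum_subtractf[symmetric]
  proof (rule sum_mono)
    fix j assume j: "j \<in> {1..J}"
    show "L' j * \<gamma> (\<theta>' j) - L j * \<gamma> (\<theta> j) \<le> (B_mat q \<gamma> S (\<theta> j) *v edge J X' j) \<bullet> w j / L j"
      unfolding w_def polar[OF j]
      by (rule anisotropic_edge_estimate[where S = S and t = "\<theta> j"])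
        (use q pos angles[OF j] S L[OF j] in auto)
  qed
  have bending: "(\<Sum>j=1..J. L' j * ((\<kappa>' (node J (j - 1)))\<^sup>2 + (\<kappa>' (node J j))\<^sup>2)) / 4
      - (\<Sum>j=1..J. L j * ((\<kappa> (node J (j - 1)))\<^sup>2 + (\<kappa> (node J j))\<^sup>2)) / 4
      \<le> (\<Sum>j=1..J.
        L j / 2 * ((\<kappa>' (node J j) - \<kappa> (node J j)) * \<kappa>' (node J j)
          + (\<kappa>' (node J (j - 1)) - \<kappa> (node J (j - 1))) * \<kappa>' (node J (j - 1)))
        + (edge J X' j \<bullet> w j) / (4 * L j)
          * ((\<kappa>' (node J j))\<^sup>2 + (\<kappa>' (node J (j - 1)))\<^sup>2))"
    unfolding sum_divide_distrib sum_subtractf[symmetric]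
  proof (rule sum_mono)
    fix j assume j: "j \<in> {1..J}"
    have "edge J X' j \<bullet> edge J X j \<le> L' j * L j"
      unfolding L_def L'_def by (rule norm_cauchy_schwarz)
    hence "L' j * (L' j - L j) \<le> edge J X' j \<bullet> w j"
      unfolding w_def inner_diff_right right_diff_distrib
      by (simp add: L'_def dot_square_norm power2_eq_square)
    note node_est = curvature_node_estimate[OF L(1)[OF j] this]
    show "L' j * ((\<kappa>' (node J (j - 1)))\<^sup>2 + (\<kappa>' (node J j))\<^sup>2) / 4
      - L j * ((\<kappa> (node J (j - 1)))\<^sup>2 + (\<kappa> (node J j))\<^sup>2) / 4
      \<le> L j / 2 * ((\<kappa>' (node J j) - \<kappa> (node J j)) * \<kappa>' (node J j)
          + (\<kappa>' (node J (j - 1)) - \<kappa> (node J (j - 1))) * \<kappa>' (node J (j - 1)))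
        + (edge J X' j \<bullet> w j) / (4 * L j)
          * ((\<kappa>' (node J j))\<^sup>2 + (\<kappa>' (node J (j - 1)))\<^sup>2)"
      using add_mono[OF node_est[of "\<kappa>' (node J j)" "\<kappa> (node J j)"]
          node_est[of "\<kappa>' (node J (j - 1))" "\<kappa> (node J (j - 1))"]]
      unfolding distrib_left diff_divide_distrib add_divide_distrib by linarith
  qed
  note law = discrete_energy_law[OF \<eta> dt X X' \<mu>' \<kappa> \<kappa>' edges step, folded L_def w_def]
  have "energy \<gamma> \<epsilon> \<sigma> J \<theta>' X' \<kappa>' - energy \<gamma> \<epsilon> \<sigma> J \<theta> X \<kappa>
    = ((\<Sum>j=1..J. L' j * \<gamma> (\<theta>' j)) - (\<Sum>j=1..J. L j * \<gamma> (\<theta> j)))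
      + \<epsilon>\<^sup>2 * ((\<Sum>j=1..J. L' j * ((\<kappa>' (node J (j - 1)))\<^sup>2 + (\<kappa>' (node J j))\<^sup>2)) / 4
        - (\<Sum>j=1..J. L j * ((\<kappa> (node J (j - 1)))\<^sup>2 + (\<kappa> (node J j))\<^sup>2)) / 4)
      - \<sigma> * ((X' 1 $ 1 - X 1 $ 1) - (X' 0 $ 1 - X 0 $ 1))"
    unfolding energy_def L_def L'_def by (simp add: algebra_simps)
  also have "\<dots> \<le> 0"
    using surface mult_left_mono[OF bending zero_le_power2[of \<epsilon>]] law by linarith
  finally show ?thesis by simp
qed

lemma min_stab_is_well_defined:
  assumes "q \<in> {0, 1}" and "C2 \<gamma>" and "\<And>t. 0 < \<gamma> t" and "\<And>t. \<gamma> (t + 2 * pi) = \<gamma> t"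
    and "q = 0 \<Longrightarrow> (\<forall>t. \<gamma> t = \<gamma> (pi + t))"
    and "q = 1 \<Longrightarrow> (\<forall>t. 3 * \<gamma> t > \<gamma> (pi + t))"
  shows "min_stab_well_defined q \<gamma>"
  unfolding min_stab_well_defined_def
proof (intro ballI conjI)
  fix t assume t: "t \<in> {-pi..pi}"
  consider "q = 0" | "q = 1" using assms(1) by auto
  note q_cases = this
  show "stab_values q \<gamma> t \<noteq> {}"
  proof (cases rule: q_cases)
    case 1
    show ?thesis unfolding 1
      by (rule stab_values_0_nonempty[OF assms(2,3)]) (use assms(5)[OF 1] in simp)
  next
    case 2
    show ?thesis unfolding 2
      by (rule stab_values_1_nonempty[OF assms(2,3,4)]) (use assms(6)[OF 2] in simp)
  qed
  have "0 \<le> s" if "s \<in> stab_values q \<gamma> t" for s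
    using q_cases
  proof cases
    case 1
    with that show ?thesis using stab_values_0_nonneg[of \<gamma> t s] assms(3) t by simp
  next
    case 2
    with that show ?thesis unfolding stab_values_def by simp
  qed
  thus "bdd_below (stab_values q \<gamma> t)" by (rule bdd_belowI)
qed

theorem theorem4p2:
  fixes q J M :: nat and \<gamma> S :: "real \<Rightarrow> real" and \<epsilon> \<eta> \<sigma> dt :: real
    and X :: "nat \<Rightarrow> real \<Rightarrow> real^2" and \<mu> \<kappa> :: "nat \<Rightarrow> real \<Rightarrow> real"
    and \<theta> :: "nat \<Rightarrow> nat \<Rightarrow> real"
  assumes "q \<in> {0, 1}" and "J \<ge> 1"
    and "0 < \<epsilon>" and "\<epsilon> \<le> 1" and "0 < \<eta>" and "0 < dt"
    and "C2 \<gamma>" and "\<And>t. 0 < \<gamma> t" and "\<And>t. \<gamma> (t + 2 * pi) = \<gamma> t"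
    and "q = 0 \<Longrightarrow> (\<forall>t. \<gamma> t = \<gamma> (pi + t))"
    and "q = 1 \<Longrightarrow> (\<forall>t. 3 * \<gamma> t > \<gamma> (pi + t))"
    and "\<And>m. m \<le> M \<Longrightarrow> X m \<in> curve_space J"
    and "\<And>m. m \<le> M \<Longrightarrow> \<mu> m \<in> fe_space J"
    and "\<And>m. m \<le> M \<Longrightarrow> \<kappa> m \<in> fe_space0 J"
    and "\<And>m j. m \<le> M \<Longrightarrow> j \<in> {1..J} \<Longrightarrow> edge J (X m) j \<noteq> 0"
    and "\<And>m. m \<le> M \<Longrightarrow> is_tangent_angle J (X m) (\<theta> m)"
    and "\<And>m. m < M \<Longrightarrow> scheme_step q \<gamma> S \<epsilon> \<eta> \<sigma> dt J (\<theta> m) (X m) (\<kappa> m)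
           (X (Suc m)) (\<mu> (Suc m)) (\<kappa> (Suc m))"
  shows "(\<forall>m\<le>M. area J (X m) = area J (X 0))
    \<and> min_stab_well_defined q \<gamma>
    \<and> ((\<forall>t\<in>{-pi..pi}. S t \<ge> min_stab q \<gamma> t) \<longrightarrow>
        (\<forall>m<M. energy \<gamma> \<epsilon> \<sigma> J (\<theta> (Suc m)) (X (Suc m)) (\<kappa> (Suc m))
                \<le> energy \<gamma> \<epsilon> \<sigma> J (\<theta> m) (X m) (\<kappa> m)))"
proof (intro conjI impI allI)
  show wd: "min_stab_well_defined q \<gamma>"
    by (rule min_stab_is_well_defined) (use assms in blast)+
  show "area J (X m) = area J (X 0)" if "m \<le> M" for m
    using that
  proof (induction m)
    case (Suc m)
    have "area J (X (Suc m)) = area J (X m)"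
      by (rule area_conserved_step[OF \<open>J \<ge> 1\<close> \<open>0 < dt\<close>])
        (use Suc.prems assms(12,15,17) in \<open>auto simp: Suc_le_eq\<close>)
    with Suc show ?case by simp
  qed simp
  fix m assume S: "\<forall>t\<in>{-pi..pi}. S t \<ge> min_stab q \<gamma> t" and m: "m < M"
  have stab: "S t \<in> stab_values q \<gamma> t" if "t \<in> {-pi..pi}" for t
    using wd S that assms(1,8)
    by (intro ge_min_stab_imp_stab_value) (auto simp: min_stab_well_defined_def)
  have le: "m \<le> M" "Suc m \<le> M" using m by auto
  show "energy \<gamma> \<epsilon> \<sigma> J (\<theta> (Suc m)) (X (Suc m)) (\<kappa> (Suc m)) \<le> energy \<gamma> \<epsilon> \<sigma> J (\<theta> m) (X m) (\<kappa> m)"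
    by (rule energy_decreasing_step[OF assms(1,5,6,8) stab assms(12)[OF le(1)] assms(12)[OF le(2)]
          assms(13)[OF le(2)] assms(14)[OF le(1)] assms(14)[OF le(2)]
          assms(15)[OF le(1)] assms(15)[OF le(2)] assms(16)[OF le(1)] assms(16)[OF le(2)] assms(17)[OF m]])
qed

end
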